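(* Let $N,n,m$ be positive integers and let $w$ be an integer with $2\le w\le n$. For $1\le k\le \lfloor n/w\rfloor\wedge w$ define $$\tilde\Gamma_k(w,n)=\sum_{j=0}^{w-k}\binom{w-k}{j}\prod_{\ell=1}^{k(w-1)-j-1}\left(1-\frac{\ell}{n-w}\right)\left[\frac{w}{n-w}\right]^{j}\sum_{\substack{i_1+\dots+i_k=j\\ i_s\ge 0}}\frac{j!}{i_1!\cdots i_k!}\prod_{\ell=1}^{k}\left[\frac{1}{i_\ell+1}\prod_{s=1}^{i_\ell}\Big(1-\frac{s}{w}\Big)\right],$$ and the polynomial $$\varphi_{w,n}(x)=1+\sum_{k=1}^{\lfloor n/w\rfloor\wedge w}\binom{w}{k}\tilde\Gamma_k(w,n)\,x^k .$$ Let $\tau$ be the first positive solution of the equation $\varphi_{w,n}(x)-x\varphi_{w,n}'(x)=0$. Then a perfect hash family $\mathrm{PHF}(N;n,m,w)$ exists as soon as $$N\ge \frac{\ln[\varphi_{w,n}'(\tau)]+(w-1)\ln(n-w)-\ln((w-1)!)}{\ln(m^{w})-\ln\left(m^{w}-w!\binom{m}{w}\right)}.$$ Moreover, the Moser–Tardos algorithm for PHF finds such a perfect hash family $\mathrm{PHF}(N;n,m,w)$ in an expected time which is polynomial in $N$, $n$ and $m$ for any fixed $w$.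
   Context: $[m]=\{1,\dots,m\}$, and $a\wedge b=\min(a,b)$. A perfect hash family $\mathrm{PHF}(N;n,m,w)$ is an $N\times n$ matrix $A$ with entries in $[m]$ such that for every set $W\subseteq[n]$ with $|W|=w$, the $N\times w$ submatrix $A|_W$ formed by the columns of $A$ with indices in $W$ has at least one row whose $w$ entries are pairwise distinct. For $W\subseteq[n]$ with $|W|=w$, let $E_W$ be the "bad" event that every row of $A|_W$ contains two equal entries. The Moser–Tardos algorithm for PHF is the following randomized procedure: Step 0: choose all $Nn$ entries of an $N\times n$ matrix independently and uniformly at random from $[m]$, obtaining $A_0$. Step $k\ge1$: given $A_{k-1}$, check all events $E_W$ ($W\subseteq[n]$, $|W|=w$); if some $E_W$ occurs, choose one such $W$ and resample independently and uniformly at random from $[m]$ all entries of $A_{k-1}|_W$, leaving all other entries unchanged, obtaining $A_k$; if no $E_W$ occurs, stop and output the current matrix (which is then a $\mathrm{PHF}(N;n,m,w)$). *)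

theory Defs
  imports "HOL-Probability.Probability" "HOL-Computational_Algebra.Polynomial"
begin

text \<open>An \<open>N \<times> n\<close> matrix is a function on index pairs (row, column), and is
  \<^const>\<open>undefined\<close> outside the index range.\<close>

type_synonym mat = "nat \<times> nat \<Rightarrow> nat"

definition mats :: "nat \<Rightarrow> nat \<Rightarrow> nat \<Rightarrow> mat set" where
  "mats N n m = ({1..N} \<times> {1..n}) \<rightarrow>\<^sub>E {1..m}"

definition is_PHF :: "nat \<Rightarrow> nat \<Rightarrow> nat \<Rightarrow> nat \<Rightarrow> mat \<Rightarrow> bool" where
  "is_PHF N n m w A \<longleftrightarrow> A \<in> mats N n m \<and>
     (\<forall>W. W \<subseteq> {1..n} \<and> card W = w \<longrightarrow> (\<exists>i\<in>{1..N}. inj_on (\<lambda>j. A (i, j)) W))"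

definition bad_event :: "nat \<Rightarrow> nat set \<Rightarrow> mat \<Rightarrow> bool" where
  "bad_event N W A \<longleftrightarrow> (\<forall>i\<in>{1..N}. \<exists>j\<in>W. \<exists>j'\<in>W. j \<noteq> j' \<and> A (i, j) = A (i, j'))"

definition bad_sets :: "nat \<Rightarrow> nat \<Rightarrow> nat \<Rightarrow> mat \<Rightarrow> nat set set" where
  "bad_sets N n w A = {W. W \<subseteq> {1..n} \<and> card W = w \<and> bad_event N W A}"

text \<open>In \<open>Gamma_tilde\<close> the upper limit \<open>k (w - 1) - j - 1\<close> equals \<open>-1\<close> for \<open>k = 1\<close>,
  \<open>j = w - 1\<close> and is nonnegative otherwise; truncated subtraction gives the intended
  empty product there. The last sum is over \<open>k\<close>-tuples \<open>(i 1, ..., i k)\<close>.\<close>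

definition Gamma_tilde :: "nat \<Rightarrow> nat \<Rightarrow> nat \<Rightarrow> real" where
  "Gamma_tilde k w n =
     (\<Sum>j = 0..w - k. real ((w - k) choose j)
        * (\<Prod>l = 1..k * (w - 1) - j - 1. 1 - real l / (real n - real w))
        * (real w / (real n - real w)) ^ j
        * (\<Sum>i \<in> {i \<in> {1..k} \<rightarrow>\<^sub>E {0..j}. (\<Sum>s = 1..k. i s) = j}.
             fact j / (\<Prod>s = 1..k. fact (i s))
             * (\<Prod>l = 1..k. 1 / (real (i l) + 1) * (\<Prod>s = 1..i l. 1 - real s / real w))))"

definition phi :: "nat \<Rightarrow> nat \<Rightarrow> real poly" where
  "phi w n = 1 + (\<Sum>k = 1..min (n div w) w. monom (real (w choose k) * Gamma_tilde k w n) k)"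

definition first_positive_zero :: "(real \<Rightarrow> real) \<Rightarrow> real \<Rightarrow> bool" where
  "first_positive_zero g t \<longleftrightarrow> 0 < t \<and> g t = 0 \<and> (\<forall>x. 0 < x \<and> x < t \<longrightarrow> g x \<noteq> 0)"

definition PHF_bound :: "nat \<Rightarrow> nat \<Rightarrow> nat \<Rightarrow> real \<Rightarrow> real" where
  "PHF_bound w n m t =
     (ln (poly (pderiv (phi w n)) t) + (real w - 1) * ln (real n - real w) - ln (fact (w - 1)))
     / (ln (real m ^ w) - ln (real m ^ w - fact w * real (m choose w)))"

text \<open>Randomness of the algorithm: \<open>\<omega> (k, i, j)\<close> is the value that Step \<open>k\<close> uses if it
  (re)samples the entry \<open>(i, j)\<close>. All these values are independent and uniform on \<open>{1..m}\<close>.\<close>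

definition mt_space :: "nat \<Rightarrow> nat \<Rightarrow> nat \<Rightarrow> (nat \<times> nat \<times> nat \<Rightarrow> nat) measure" where
  "mt_space N n m =
     Pi\<^sub>M (UNIV \<times> {1..N} \<times> {1..n}) (\<lambda>_. uniform_count_measure {1..m})"

text \<open>The rule by which the algorithm chooses one of the occurring bad events is arbitrary:
  it may depend on all matrices \<open>[A\<^sub>0, ..., A\<^sub>k]\<close> seen so far.\<close>

definition selection_rule :: "nat \<Rightarrow> nat \<Rightarrow> nat \<Rightarrow> (mat list \<Rightarrow> nat set) \<Rightarrow> bool" where
  "selection_rule N n w sel \<longleftrightarrow>
     (\<forall>h. h \<noteq> [] \<and> bad_sets N n w (last h) \<noteq> {} \<longrightarrow> sel h \<in> bad_sets N n w (last h))"

text \<open>\<open>mt_history \<dots> k\<close> is the list \<open>[A\<^sub>0, ..., A\<^sub>k]\<close>; after the algorithm has stopped, the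
  output matrix is repeated.\<close>

primrec mt_history ::
  "nat \<Rightarrow> nat \<Rightarrow> nat \<Rightarrow> (mat list \<Rightarrow> nat set) \<Rightarrow> (nat \<times> nat \<times> nat \<Rightarrow> nat) \<Rightarrow> nat \<Rightarrow> mat list"
where
  "mt_history N n w sel \<omega> 0 = [\<lambda>(i, j). \<omega> (0, i, j)]"
| "mt_history N n w sel \<omega> (Suc k) =
     (let h = mt_history N n w sel \<omega> k; A = last h
      in h @ [if bad_sets N n w A = {} then A
              else (\<lambda>(i, j). if j \<in> sel h then \<omega> (Suc k, i, j) else A (i, j))])"

definition mt_matrix ::
  "nat \<Rightarrow> nat \<Rightarrow> nat \<Rightarrow> (mat list \<Rightarrow> nat set) \<Rightarrow> (nat \<times> nat \<times> nat \<Rightarrow> nat) \<Rightarrow> nat \<Rightarrow> mat"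
where
  "mt_matrix N n w sel \<omega> k = last (mt_history N n w sel \<omega> k)"

definition mt_outputs ::
  "nat \<Rightarrow> nat \<Rightarrow> nat \<Rightarrow> (mat list \<Rightarrow> nat set) \<Rightarrow> (nat \<times> nat \<times> nat \<Rightarrow> nat) \<Rightarrow> mat \<Rightarrow> bool"
where
  "mt_outputs N n w sel \<omega> A \<longleftrightarrow>
     (\<exists>k. (\<forall>i<k. bad_sets N n w (mt_matrix N n w sel \<omega> i) \<noteq> {})
        \<and> bad_sets N n w (mt_matrix N n w sel \<omega> k) = {}
        \<and> A = mt_matrix N n w sel \<omega> k)"

text \<open>Running time, where \<open>s\<close> is the cost of sampling one entry and \<open>c\<close> the cost of comparing
  two entries. Step 0 samples \<open>N n\<close> entries. Summand \<open>k\<close> of the series is the cost of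
  Step \<open>k + 1\<close>, which is executed iff the checks of all earlier steps found a bad event: it
  compares all pairs of entries in all \<open>N\<close> rows for all \<open>w\<close>-sets of columns, and resamples
  \<open>N w\<close> entries if a bad event occurs. The time of a nonterminating run is infinite as
  soon as some step cost is nonzero.\<close>

definition mt_time ::
  "nat \<Rightarrow> nat \<Rightarrow> nat \<Rightarrow> nat \<Rightarrow> nat \<Rightarrow> (mat list \<Rightarrow> nat set) \<Rightarrow> (nat \<times> nat \<times> nat \<Rightarrow> nat) \<Rightarrow> ennreal"
where
  "mt_time s c N n w sel \<omega> =
     of_nat (N * n * s)
     + (\<Sum>k. if \<forall>i<k. bad_sets N n w (mt_matrix N n w sel \<omega> i) \<noteq> {}
             then of_nat ((n choose w) * N * (w choose 2) * c
                    + (if bad_sets N n w (mt_matrix N n w sel \<omega> k) \<noteq> {} then N * w * s else 0))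
             else 0)"

definition poly_bounded :: "(nat \<Rightarrow> nat \<Rightarrow> nat \<Rightarrow> nat) \<Rightarrow> bool" where
  "poly_bounded f \<longleftrightarrow>
     (\<exists>C d. \<forall>N n m. 1 \<le> N \<and> 1 \<le> n \<and> 1 \<le> m \<longrightarrow> f N n m \<le> C * (N + n + m) ^ d)"

end

theory Submission imports Defs begin

text \<open>Each resampling step is explained by a witness: layers of pairwise disjoint column sets, in
  which every set meets some set of the next layer and the last layer is the set resampled in that
  step. For the current matrix \<open>A\<close>, \<open>occ L A\<close> is the probability that all sets of the witness \<open>L\<close> are
  bad when its layers are resampled one after the other, starting from \<open>A\<close>. Prepending the set
  resampled now to a future witness is injective, so the sum of \<open>occ L\<close> over all witnesses drops by
  at least one, in conditional mean, with each executed step, whatever the selection rule does.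
  Hence the expected number of steps is at most the initial mean of this potential, which is the sum
  of \<open>p ^ |L|\<close>, where \<open>p\<close> is the probability of one bad event.

  The coefficients of \<open>\<phi>\<close> count exactly the \<open>k\<close>-element families of disjoint column sets that all meet
  a given one, up to the scaling \<open>C ^ k\<close> with \<open>C = (n - w) ^ (w - 1) / (w - 1)!\<close>. With \<open>\<mu> = \<tau> / C\<close>
  the bound on \<open>N\<close> says \<open>p * \<phi>(\<tau>) \<le> \<mu>\<close>, which is the condition of the cluster expansion local lemma
  and bounds the sum by \<open>\<mu>\<close> times the number of column sets; finally \<open>\<mu> \<le> 1\<close> by the equation
  for \<open>\<tau>\<close>.\<close>

section \<open>Means over finite function spaces\<close>

text \<open>Expectations are averages over finite sets, which keeps the probabilistic argument
  elementary; \<open>nn_integral_PiM_uniform_restrict\<close> later connects them with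
  \<open>mt_space\<close>.\<close>

definition mean :: "'a set \<Rightarrow> ('a \<Rightarrow> real) \<Rightarrow> real" where
  "mean X f = (\<Sum>x\<in>X. f x) / real (card X)"

lemma mean_cong: "X = Y \<Longrightarrow> (\<And>x. x \<in> Y \<Longrightarrow> f x = g x) \<Longrightarrow> mean X f = mean Y g"
  by (auto simp: mean_def intro: sum.cong)

lemma mean_mono: "(\<And>x. x \<in> X \<Longrightarrow> f x \<le> g x) \<Longrightarrow> mean X f \<le> mean X g"
  by (simp add: mean_def divide_right_mono sum_mono)

lemma mean_nonneg: "(\<And>x. x \<in> X \<Longrightarrow> 0 \<le> f x) \<Longrightarrow> 0 \<le> mean X f"
  by (simp add: mean_def sum_nonneg)

lemma mean_const [simp]: "finite X \<Longrightarrow> X \<noteq> {} \<Longrightarrow> mean X (\<lambda>_. c) = c"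
  by (simp add: mean_def)

lemma mean_sum: "mean X (\<lambda>x. \<Sum>i\<in>I. f i x) = (\<Sum>i\<in>I. mean X (f i))"
  unfolding mean_def sum_divide_distrib[symmetric] by (subst sum.swap) simp

lemma mean_add: "mean X (\<lambda>x. f x + g x) = mean X f + mean X g"
  by (simp add: mean_def sum.distrib add_divide_distrib)

lemma mean_diff: "mean X (\<lambda>x. f x - g x) = mean X f - mean X g"
  by (simp add: mean_def sum_subtractf diff_divide_distrib)

lemma mean_mult_left: "mean X (\<lambda>x. c * f x) = c * mean X f"
  by (simp add: mean_def sum_distrib_left)

lemma mean_indicator: "finite X \<Longrightarrow> mean X (\<lambda>x. of_bool (P x)) = card {x \<in> X. P x} / card X"
  by (simp add: mean_def of_bool_def sum.If_cases Int_def)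

lemma override_on_PiE:
  assumes "A \<in> C \<rightarrow>\<^sub>E T" "B \<in> C \<rightarrow>\<^sub>E T"
  shows "override_on A B S \<in> C \<rightarrow>\<^sub>E T"
  using assms by (auto simp: override_on_def PiE_def Pi_def extensional_def)

text \<open>Exchanging the \<open>S\<close>-parts of two independent uniform functions preserves their joint
  distribution, so the old values on \<open>S\<close> are independent of the resampled function.\<close>

lemma mean_resample_mult:
  fixes C :: "'a set" and T :: "'b set" and f g :: "('a \<Rightarrow> 'b) \<Rightarrow> real"
  defines "X \<equiv> C \<rightarrow>\<^sub>E T"
  assumes f: "\<And>A B. A \<in> X \<Longrightarrow> B \<in> X \<Longrightarrow> f (override_on B A S) = f A"
  shows "mean X (\<lambda>A. f A * mean X (\<lambda>B. g (override_on A B S))) = mean X f * mean X g"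
proof -
  define h where "h = (\<lambda>(A :: 'a \<Rightarrow> 'b, B). (override_on A B S, override_on B A S))"
  have hX: "h z \<in> X \<times> X" if "z \<in> X \<times> X" for z
    using that unfolding h_def X_def by (auto intro!: override_on_PiE)
  have hh: "h (h z) = z" for z
    by (auto simp: h_def override_on_def fun_eq_iff split: prod.splits)
  have bij: "bij_betw h (X \<times> X) (X \<times> X)"
    by (rule bij_betw_byWitness[where f' = h]) (use hX hh in blast)+
  have "(\<Sum>A\<in>X. \<Sum>B\<in>X. f A * g (override_on A B S)) = (\<Sum>z\<in>X \<times> X. f (snd (h z)) * g (fst (h z)))"
    unfolding sum.cartesian_product by (rule sum.cong) (auto simp: h_def f)
  also have "\<dots> = (\<Sum>z\<in>X \<times> X. f (snd z) * g (fst z))"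
    by (rule sum.reindex_bij_betw[OF bij])
  also have "\<dots> = (\<Sum>B\<in>X. g B) * (\<Sum>A\<in>X. f A)"
    unfolding sum_product sum.cartesian_product by (rule sum.cong) (auto simp: mult.commute)
  finally show ?thesis
    by (simp add: mean_def sum_distrib_left sum_divide_distrib[symmetric] mult.commute)
qed

text \<open>The case of a constant first factor: refreshing any part of a uniform function leaves it
  uniform.\<close>

corollary mean_resample:
  fixes T :: "'b set" and g :: "('a \<Rightarrow> 'b) \<Rightarrow> real"
  assumes "finite C" "finite T" "T \<noteq> {}"
  shows "mean (C \<rightarrow>\<^sub>E T) (\<lambda>A. mean (C \<rightarrow>\<^sub>E T) (\<lambda>B. g (override_on A B S))) = mean (C \<rightarrow>\<^sub>E T) g"
proof -
  have "finite (C \<rightarrow>\<^sub>E T)" "(C \<rightarrow>\<^sub>E T) \<noteq> {}"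
    using assms by (auto simp: finite_PiE PiE_eq_empty_iff)
  then show ?thesis
    using mean_resample_mult[of C T "\<lambda>_. 1" S g] by simp
qed

text \<open>The second resampling can be absorbed into the first fresh function, which stays uniform
  by \<open>mean_resample\<close>. As the union is symmetric, successive resamplings commute in
  mean.\<close>

lemma mean_resample_twice:
  fixes T :: "'b set" and g :: "('a \<Rightarrow> 'b) \<Rightarrow> real"
  assumes "finite C" "finite T" "T \<noteq> {}"
  shows "mean (C \<rightarrow>\<^sub>E T) (\<lambda>B. mean (C \<rightarrow>\<^sub>E T) (\<lambda>B'. g (override_on (override_on A B S) B' S')))
       = mean (C \<rightarrow>\<^sub>E T) (\<lambda>B. g (override_on A B (S \<union> S')))"
proof -
  have "override_on (override_on A B S) B' S' = override_on A (override_on B B' S') (S \<union> S')" for B B'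
    by (auto simp: override_on_def fun_eq_iff)
  then show ?thesis
    using mean_resample[OF assms, where g = "\<lambda>B. g (override_on A B (S \<union> S'))"] by simp
qed

text \<open>A function on \<open>C\<close> is a pair of functions on \<open>S\<close> and on
  \<open>C - S\<close>; the second component only contributes a cardinality, which cancels.\<close>

lemma mean_depends_on_subset:
  fixes T :: "'b set" and g :: "('a \<Rightarrow> 'b) \<Rightarrow> real"
  assumes "finite C" "finite T" "T \<noteq> {}" "S \<subseteq> C"
  shows "mean (C \<rightarrow>\<^sub>E T) (\<lambda>A. g (restrict A S)) = mean (S \<rightarrow>\<^sub>E T) g"
proof -
  define R where "R = C - S"
  have fin: "finite S" "finite R" using assms finite_subset by (auto simp: R_def)
  have bij: "bij_betw (\<lambda>(A, B). \<lambda>x. if x \<in> S then A x else B x)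
     ((S \<rightarrow>\<^sub>E T) \<times> (R \<rightarrow>\<^sub>E T)) (C \<rightarrow>\<^sub>E T)"
    by (rule bij_betw_byWitness[where f' = "\<lambda>A. (restrict A S, restrict A R)"])
      (use assms(4) in \<open>auto simp: R_def PiE_def Pi_def extensional_def fun_eq_iff\<close>)
  have "(\<Sum>A\<in>C \<rightarrow>\<^sub>E T. g (restrict A S))
      = (\<Sum>z\<in>(S \<rightarrow>\<^sub>E T) \<times> (R \<rightarrow>\<^sub>E T). g (restrict ((\<lambda>(A, B). \<lambda>x. if x \<in> S then A x else B x) z) S))"
    by (rule sum.reindex_bij_betw[OF bij, symmetric])
  also have "\<dots> = (\<Sum>z\<in>(S \<rightarrow>\<^sub>E T) \<times> (R \<rightarrow>\<^sub>E T). g (fst z))"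
    by (rule sum.cong) (auto simp: PiE_def extensional_def fun_eq_iff intro!: arg_cong[where f = g])
  also have "\<dots> = (\<Sum>A\<in>S \<rightarrow>\<^sub>E T. g A) * card (R \<rightarrow>\<^sub>E T)"
    by (simp add: sum.cartesian_product' sum_distrib_right mult.commute)
  finally have "(\<Sum>A\<in>C \<rightarrow>\<^sub>E T. g (restrict A S)) = (\<Sum>A\<in>S \<rightarrow>\<^sub>E T. g A) * card (R \<rightarrow>\<^sub>E T)" .
  moreover have "card (C \<rightarrow>\<^sub>E T) = card (S \<rightarrow>\<^sub>E T) * card (R \<rightarrow>\<^sub>E T)"
    using bij_betw_same_card[OF bij] by (simp add: card_cartesian_product)
  moreover have "card (R \<rightarrow>\<^sub>E T) > 0"
    using assms fin by (simp add: card_PiE card_gt_0_iff)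
  ultimately show ?thesis by (simp add: mean_def)
qed

section \<open>The probability of a bad event\<close>

text \<open>The numerator counts the non-injective maps from \<open>w\<close> columns to
  \<open>m\<close> symbols. The negative logarithm of this probability is the denominator of
  \<open>PHF_bound\<close>.\<close>

definition row_bad_prob :: "nat \<Rightarrow> nat \<Rightarrow> real" where
  "row_bad_prob m w = (real m ^ w - fact w * real (m choose w)) / real m ^ w"

text \<open>Induction with \<open>T\<close> varying: the value at the new point is removed from the
  target of the remaining points.\<close>

lemma card_inj_on_PiE:
  assumes "finite S" "finite T"
  shows "card {f \<in> S \<rightarrow>\<^sub>E T. inj_on f S} = fact (card S) * (card T choose card S)"
  using assms
proof (induction S arbitrary: T)
  case empty
  then show ?case by (simp add: card_1_singleton_iff)
next
  case (insert a S)
  let ?G = "\<lambda>y. {g \<in> S \<rightarrow>\<^sub>E T - {y}. inj_on g S}"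
  have fin: "finite (?G y)" for y
    using insert by (auto simp: finite_PiE)
  have "card {f \<in> insert a S \<rightarrow>\<^sub>E T. inj_on f (insert a S)} = card (SIGMA y:T. ?G y)"
  proof -
    have eq: "{(y, g). y \<in> T \<and> g \<in> S \<rightarrow>\<^sub>E T - {y} \<and> inj_on g S} = (SIGMA y:T. ?G y)" by auto
    have "inj_on (\<lambda>(y, g). g(a := y)) (SIGMA y:T. ?G y)"
      using extensional_funcset_extend_domain_inj_onI[OF insert.hyps(2), of T] by (simp only: eq)
    then show ?thesis
      unfolding extensional_funcset_extend_domain_inj_on_eq[OF insert.hyps(2)] eq
      by (rule card_image)
  qed
  also have "\<dots> = (\<Sum>y\<in>T. fact (card S) * (card (T - {y}) choose card S))"
    using insert fin by (simp add: card_SigmaI)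
  also have "\<dots> = fact (card S) * (card T * ((card T - 1) choose card S))"
    by (simp add: mult_ac)
  also have "card T * ((card T - 1) choose card S) = Suc (card S) * (card T choose Suc (card S))"
    using Suc_times_binomial_eq[of "card T - 1" "card S"] by (cases "card T") (auto simp: mult_ac)
  finally show ?case using insert.hyps by (simp add: algebra_simps)
qed

lemma mean_inj_on:
  assumes "finite S" "finite T"
  shows "mean (S \<rightarrow>\<^sub>E T) (\<lambda>f. of_bool (inj_on f S))
    = fact (card S) * real (card T choose card S) / real (card T) ^ card S"
  using assms by (simp add: mean_indicator finite_PiE card_PiE card_inj_on_PiE)

text \<open>Injectivity along \<open>V\<close> in row \<open>i\<close> depends only on the cells
  \<open>{i} \<times> V\<close>, so the matrix may be replaced by a uniform function on these cells;
  then pass to the complement.\<close>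

lemma mean_row_bad:
  assumes "1 \<le> m" "w \<le> m" "V \<subseteq> {1..n}" "card V = w" "i \<in> {1..N}"
  shows "mean (mats N n m) (\<lambda>A. of_bool (\<not> inj_on (\<lambda>j. A (i, j)) V)) = row_bad_prob m w"
proof -
  let ?S = "{i} \<times> V"
  have V: "finite V" using assms(3) finite_subset by blast
  have "mean (mats N n m) (\<lambda>A. of_bool (inj_on (\<lambda>j. A (i, j)) V))
      = mean (mats N n m) (\<lambda>A. of_bool (inj_on (restrict A ?S) ?S))"
    by (intro mean_cong refl arg_cong[where f = of_bool]) (auto simp: inj_on_def)
  also have "\<dots> = mean (?S \<rightarrow>\<^sub>E {1..m}) (\<lambda>f. of_bool (inj_on f ?S))"
    unfolding mats_def using assms by (intro mean_depends_on_subset) auto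
  also have "\<dots> = fact w * real (m choose w) / real m ^ w"
    using assms V by (subst mean_inj_on) (auto simp: card_cartesian_product)
  finally have "mean (mats N n m) (\<lambda>A. of_bool (inj_on (\<lambda>j. A (i, j)) V))
      = fact w * real (m choose w) / real m ^ w" .
  moreover have "mean (mats N n m) (\<lambda>A. 1) = 1"
    using assms by (intro mean_const) (auto simp: mats_def finite_PiE PiE_eq_empty_iff)
  ultimately show ?thesis
    using assms(1) mean_diff[of "mats N n m" "\<lambda>_. 1" "\<lambda>A. of_bool (inj_on (\<lambda>j. A (i, j)) V)"]
    by (simp add: row_bad_prob_def of_bool_not_iff diff_divide_distrib)
qed

lemma mean_bad_event:
  assumes "1 \<le> m" "w \<le> m" "V \<subseteq> {1..n}" "card V = w"
  shows "mean (mats N n m) (\<lambda>A. of_bool (bad_event N V A)) = row_bad_prob m w ^ N"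
proof -
  let ?M = "mats N n m" and ?b = "\<lambda>i (A :: mat). \<not> inj_on (\<lambda>j. A (i, j)) V"
  have ne: "finite ?M" "?M \<noteq> {}"
    using assms by (auto simp: mats_def finite_PiE PiE_eq_empty_iff)
  have "mean ?M (\<lambda>A. of_bool (\<forall>i\<in>R. ?b i A)) = row_bad_prob m w ^ card R"
    if "finite R" "R \<subseteq> {1..N}" for R
    using that
  proof (induction R)
    case empty
    then show ?case using ne by simp
  next
    case (insert i R)
    \<comment> \<open>Row independence: resampling row \<open>i\<close> does not touch the rows in
      \<open>R\<close>, so an inner mean over such a resampling can be inserted for free, and
      \<open>mean_resample_mult\<close> then factors the expectation.\<close>
    let ?S = "{i} \<times> (UNIV :: nat set)"
    have R: "(\<forall>i\<in>R. ?b i (override_on A B ?S)) \<longleftrightarrow> (\<forall>i\<in>R. ?b i A)" for A B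
      using insert.hyps(2) by (intro ball_cong refl) (auto simp: inj_on_def override_on_def)
    have "mean ?M (\<lambda>A. of_bool (\<forall>i\<in>insert i R. ?b i A))
        = mean ?M (\<lambda>A. of_bool (?b i A) * mean ?M (\<lambda>B. of_bool (\<forall>i\<in>R. ?b i (override_on A B ?S))))"
      unfolding R by (simp add: mean_const[OF ne] of_bool_conj)
    also have "\<dots> = mean ?M (\<lambda>A. of_bool (?b i A)) * mean ?M (\<lambda>A. of_bool (\<forall>i\<in>R. ?b i A))"
      unfolding mats_def by (rule mean_resample_mult) (simp add: inj_on_def override_on_def)
    also have "\<dots> = row_bad_prob m w ^ card (insert i R)"
      using insert mean_row_bad[OF assms, of i N] by simp
    finally show ?case .
  qed
  from this[of "{1..N}"]
  have "mean ?M (\<lambda>A. of_bool (\<forall>i\<in>{1..N}. ?b i A)) = row_bad_prob m w ^ N" by simp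
  moreover have "bad_event N V A \<longleftrightarrow> (\<forall>i\<in>{1..N}. ?b i A)" for A
    unfolding bad_event_def inj_on_def by blast
  ultimately show ?thesis by simp
qed

text \<open>Constant maps are not injective because \<open>2 \<le> w\<close>, and injective maps
  exist because \<open>w \<le> m\<close>. Strict bounds make the denominator of
  \<open>PHF_bound\<close> positive.\<close>

lemma row_bad_prob_bounds:
  assumes "2 \<le> w" "w \<le> m"
  shows "0 < row_bad_prob m w" "row_bad_prob m w < 1"
proof -
  let ?X = "{..<w} \<rightarrow>\<^sub>E {..<m}"
  have "\<not> inj_on (\<lambda>i\<in>{..<w}. 0 :: nat) {..<w}"
    using assms by (auto dest: inj_onD[of _ _ 0 1])
  then have "(\<lambda>i\<in>{..<w}. 0) \<in> ?X - {f \<in> ?X. inj_on f {..<w}}"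
    using assms by auto
  then have "{f \<in> ?X. inj_on f {..<w}} \<subset> ?X" by blast
  then have "card {f \<in> ?X. inj_on f {..<w}} < card ?X"
    by (intro psubset_card_mono) (simp_all add: finite_PiE)
  then have "fact w * (m choose w) < m ^ w"
    by (simp add: card_inj_on_PiE card_PiE)
  then have "real (fact w * (m choose w)) < real (m ^ w)"
    by (simp only: of_nat_less_iff)
  then show "0 < row_bad_prob m w"
    using assms by (simp add: row_bad_prob_def)
  show "row_bad_prob m w < 1" using assms by (simp add: row_bad_prob_def field_simps)
qed

section \<open>Layered witnesses\<close>

definition col_sets :: "nat \<Rightarrow> nat \<Rightarrow> nat set set" where
  "col_sets n w = {W. W \<subseteq> {1..n} \<and> card W = w}"

definition meets :: "'a set \<Rightarrow> 'a set set \<Rightarrow> bool" where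
  "meets W I \<longleftrightarrow> (\<exists>V\<in>I. V \<inter> W \<noteq> {})"

text \<open>Events are dependent when their column sets meet, so these are the independent sets of
  the dependency graph within the neighbourhood of \<open>I\<close>. A nonempty set meets itself and
  hence may recur in the next family.\<close>

definition nbr_families :: "nat \<Rightarrow> nat \<Rightarrow> nat set set \<Rightarrow> nat set set set" where
  "nbr_families n w I = {J. J \<subseteq> col_sets n w \<and> pairwise disjnt J \<and> (\<forall>V\<in>J. meets V I)}"

text \<open>Witnesses for a resampling step: the last entry contains only the set resampled in that
  step, and earlier entries contain earlier resamplings. Leading layers may be empty, so that all
  witnesses of a run of bounded length can be given the same number of layers.\<close>

primrec layers :: "nat \<Rightarrow> nat \<Rightarrow> nat \<Rightarrow> nat set set list set" where
  "layers n w 0 = (\<lambda>W. [{W}]) ` col_sets n w"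
| "layers n w (Suc h) = (\<Union>L\<in>layers n w h. (\<lambda>J. J # L) ` nbr_families n w (hd L))"

text \<open>\<open>I\<close> is the layer being passed, which is known not to meet \<open>W\<close>.
  Scanning from the earliest layer, \<open>W\<close> joins the layer just before the first one that
  it meets; if it meets none, it has no influence on the explained step and is dropped.\<close>

fun put :: "'a set \<Rightarrow> 'a set set \<Rightarrow> 'a set set list \<Rightarrow> 'a set set list" where
  "put W I [] = [I]"
| "put W I (J # L) = (if meets W J then insert W I # J # L else I # put W J L)"

fun unput :: "'a set \<Rightarrow> 'a set set list \<Rightarrow> 'a set set list" where
  "unput W [] = []"
| "unput W (I # L) = (if meets W I then (I - {W}) # L else I # unput W L)"

text \<open>In the result of \<open>put\<close>, the first layer meeting \<open>W\<close> is the one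
  that received it; if \<open>W\<close> was dropped, no layer meets it. Hence \<open>put\<close>
  with \<open>W\<close> and \<open>I\<close> fixed is injective.\<close>

lemma unput_put:
  assumes "W \<noteq> {}" "\<not> meets W I"
  shows "unput W (put W I L) = I # L"
  using assms(2)
proof (induction L arbitrary: I)
  case (Cons J L)
  have "W \<notin> I" "meets W (insert W I)"
    using Cons.prems assms(1) by (auto simp: meets_def)
  then show ?case using Cons by auto
qed simp

lemma finite_col_sets [simp]: "finite (col_sets n w)"
  by (rule finite_subset[of _ "Pow {1..n}"]) (auto simp: col_sets_def)

lemma card_col_sets: "card (col_sets n w) = n choose w"
  using n_subsets[of "{1..n}" w] by (simp add: col_sets_def)

lemma finite_nbr_families [simp]: "finite (nbr_families n w I)"
  by (rule finite_subset[of _ "Pow (col_sets n w)"]) (auto simp: nbr_families_def)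

lemma finite_layers [simp]: "finite (layers n w h)"
  by (induction h) auto

lemma layers_not_Nil: "L \<in> layers n w h \<Longrightarrow> L \<noteq> []"
  by (induction h) auto

lemma layers_families:
  "L \<in> layers n w h \<Longrightarrow> I \<in> set L \<Longrightarrow> I \<subseteq> col_sets n w \<and> pairwise disjnt I"
  by (induction h arbitrary: L) (force simp: nbr_families_def)+

lemma layers_Suc_iff:
  "J # L \<in> layers n w (Suc h) \<longleftrightarrow> L \<in> layers n w h \<and> J \<in> nbr_families n w (hd L)"
  by auto

declare layers.simps(2) [simp del]

lemma empty_nbr_families [simp]: "{} \<in> nbr_families n w I"
  by (simp add: nbr_families_def)

lemma put_not_Nil: "put W I L \<noteq> []"
  by (cases L) auto

lemma hd_put: "hd (put W J L) = J \<or> hd (put W J L) = insert W J"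
  by (cases L) auto

lemma nbr_families_mono: "I \<subseteq> I' \<Longrightarrow> nbr_families n w I \<subseteq> nbr_families n w I'"
  by (fastforce simp: nbr_families_def meets_def)

lemma insert_nbr_families:
  assumes "I \<in> nbr_families n w J" "W \<in> col_sets n w" "\<not> meets W I" "meets W J"
  shows "insert W I \<in> nbr_families n w J"
  using assms by (auto simp: nbr_families_def pairwise_insert meets_def disjnt_def)

text \<open>The receiving layer stays disjoint since \<open>W\<close> does not meet it, and
  \<open>W\<close> meets the layer after it. Enlarging a layer only weakens the condition on the
  layer before it.\<close>

lemma put_layers:
  assumes "W \<in> col_sets n w" "I # L \<in> layers n w (Suc h)" "\<not> meets W I"
  shows "put W I L \<in> layers n w (Suc h)"
  using assms(2,3)
proof (induction h arbitrary: I L)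
  case 0
  then obtain V where V: "V \<in> col_sets n w" "L = [{V}]" "I \<in> nbr_families n w {V}"
    by (auto simp: layers_Suc_iff)
  show ?case
  proof (cases "meets W {V}")
    case True
    then have "insert W I \<in> nbr_families n w {V}"
      using V 0 assms(1) insert_nbr_families by blast
    then show ?thesis
      using True V by (simp add: layers_Suc_iff)
  qed (use V in \<open>simp add: layers_Suc_iff\<close>)
next
  case (Suc h)
  then have L0: "L \<in> layers n w (Suc h)" "I \<in> nbr_families n w (hd L)"
    by (simp_all only: layers_Suc_iff)
  then obtain J K where L: "L = J # K"
    using layers_not_Nil by (meson neq_Nil_conv)
  show ?case
  proof (cases "meets W J")
    case True
    have "insert W I \<in> nbr_families n w J"
      using insert_nbr_families[OF _ assms(1) Suc.prems(2) True] L0(2) by (simp add: L)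
    then show ?thesis
      using True L0(1) layers_Suc_iff[of "insert W I" L n w "Suc h"] by (simp add: L)
  next
    case False
    then have "put W J K \<in> layers n w (Suc h)"
      using Suc.IH[OF L0(1)[unfolded L]] by blast
    moreover have "I \<in> nbr_families n w (hd (put W J K))"
      using hd_put[of W J K] L0(2) nbr_families_mono[OF subset_insertI[of J W], of n w] by (auto simp: L)
    ultimately show ?thesis
      using layers_Suc_iff[of I "put W J K" n w "Suc h"] False by (simp add: L)
  qed
qed

lemma single_layers: "W \<in> col_sets n w \<Longrightarrow> replicate h {} @ [{W}] \<in> layers n w h"
  by (induction h) (auto simp: layers_Suc_iff)

text \<open>\<open>put\<close> never alters the last layer. If that layer is \<open>{W}\<close>,
  then \<open>W\<close> meets it and has been inserted into some earlier layer, which is therefore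
  not empty.\<close>

lemma put_neq_single:
  assumes "W \<noteq> {}" "L \<noteq> []"
  shows "put W I L \<noteq> replicate h {} @ [{W}]"
  using assms(2)
proof (induction h arbitrary: I L)
  case 0
  then show ?case by (cases L) (auto simp: put_not_Nil)
next
  case (Suc h)
  then obtain J K where L: "L = J # K" by (cases L) auto
  show ?case
  proof (cases "K = []")
    case True
    then show ?thesis using assms(1) by (cases h) (auto simp: L meets_def)
  next
    case False
    then show ?thesis using Suc.IH[of K J] by (auto simp: L)
  qed
qed

section \<open>The potential\<close>

primrec occ :: "nat \<Rightarrow> nat \<Rightarrow> nat \<Rightarrow> nat set set list \<Rightarrow> mat \<Rightarrow> real" where
  "occ N n m [] A = 1"
| "occ N n m (I # L) A = of_bool (\<forall>V\<in>I. bad_event N V A)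
     * mean (mats N n m) (\<lambda>B. occ N n m L (override_on A B (UNIV \<times> \<Union>I)))"

lemma occ_nonneg: "0 \<le> occ N n m L A"
  by (induction L arbitrary: A) (auto intro!: mult_nonneg_nonneg mean_nonneg)

lemma finite_mats [simp]: "finite (mats N n m)"
  by (simp add: mats_def finite_PiE)

lemma mats_not_empty [simp]: "1 \<le> m \<Longrightarrow> mats N n m \<noteq> {}"
  by (auto simp: mats_def PiE_eq_empty_iff)

lemma bad_event_cong:
  "(\<And>i j. j \<in> W \<Longrightarrow> A (i, j) = B (i, j)) \<Longrightarrow> bad_event N W A \<longleftrightarrow> bad_event N W B"
  by (simp add: bad_event_def)

lemma bad_event_override_disjoint:
  "W \<inter> U = {} \<Longrightarrow> bad_event N W (override_on A B (UNIV \<times> U)) \<longleftrightarrow> bad_event N W A"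
  by (rule bad_event_cong) (auto simp: override_on_def)

lemma bad_event_override_subset:
  "W \<subseteq> U \<Longrightarrow> bad_event N W (override_on A B (UNIV \<times> U)) \<longleftrightarrow> bad_event N W B"
  by (rule bad_event_cong) (auto simp: override_on_def)

lemma bad_family_override_disjoint:
  assumes "\<not> meets W I"
  shows "(\<forall>V\<in>I. bad_event N V (override_on A B (UNIV \<times> W))) \<longleftrightarrow> (\<forall>V\<in>I. bad_event N V A)"
  using assms bad_event_override_disjoint[of _ W N A B] by (auto simp: meets_def)

text \<open>The resampling of \<open>W\<close> commutes with that of each layer not meeting
  \<open>W\<close>, so it can be postponed until it merges with the resampling of the layer in which
  \<open>put\<close> places \<open>W\<close>.\<close>

lemma occ_put:
  assumes "1 \<le> m" "bad_event N W A" "\<not> meets W I"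
  shows "mean (mats N n m) (\<lambda>B. occ N n m (I # L) (override_on A B (UNIV \<times> W)))
    \<le> occ N n m (put W I L) A"
  using assms(2,3)
proof (induction L arbitrary: I A)
  case Nil
  then show ?case
    using assms(1) by (simp add: bad_family_override_disjoint)
next
  case (Cons J L)
  let ?M = "mats N n m" and ?c = "of_bool (\<forall>V\<in>I. bad_event N V A) :: real"
  have twice: "mean ?M (\<lambda>B. mean ?M (\<lambda>B'. g (override_on (override_on A B S) B' S')))
      = mean ?M (\<lambda>B. g (override_on A B (S \<union> S')))" for g A and S S' :: "(nat \<times> nat) set"
    unfolding mats_def using assms(1) by (intro mean_resample_twice) auto
  have "mean ?M (\<lambda>B. occ N n m (I # J # L) (override_on A B (UNIV \<times> W)))
      = ?c * mean ?M (\<lambda>B. mean ?M (\<lambda>B'. occ N n m (J # L)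
          (override_on (override_on A B (UNIV \<times> W)) B' (UNIV \<times> \<Union>I))))"
    by (simp only: occ.simps(2)[of N n m I] bad_family_override_disjoint[OF Cons.prems(2)] mean_mult_left)
  also have "\<dots> = ?c * mean ?M (\<lambda>B. occ N n m (J # L) (override_on A B (UNIV \<times> W \<union> UNIV \<times> \<Union>I)))"
    by (simp only: twice[where g = "occ N n m (J # L)"])
  also have "\<dots> \<le> occ N n m (put W I (J # L)) A"
  proof (cases "meets W J")
    case True
    have "(UNIV :: nat set) \<times> W \<union> UNIV \<times> \<Union>I = UNIV \<times> \<Union>(insert W I)" by auto
    then show ?thesis using True Cons.prems(1) by (simp del: Union_insert)
  next
    case False
    \<comment> \<open>The columns of \<open>W\<close> are untouched while \<open>I\<close> is
      resampled, so \<open>W\<close> is still bad and the induction hypothesis applies to the new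
      matrix.\<close>
    have W: "bad_event N W (override_on A B (UNIV \<times> \<Union>I))" for B
      using Cons.prems bad_event_override_disjoint[of W "\<Union>I" N A B] by (auto simp: meets_def)
    have "mean ?M (\<lambda>B. occ N n m (J # L) (override_on A B (UNIV \<times> W \<union> UNIV \<times> \<Union>I)))
        = mean ?M (\<lambda>B. mean ?M (\<lambda>B'. occ N n m (J # L)
            (override_on (override_on A B (UNIV \<times> \<Union>I)) B' (UNIV \<times> W))))"
      by (simp only: twice[where g = "occ N n m (J # L)"] Un_commute)
    also have "\<dots> \<le> mean ?M (\<lambda>B. occ N n m (put W J L) (override_on A B (UNIV \<times> \<Union>I)))"
      by (intro mean_mono Cons.IH[OF W False])
    finally show ?thesis using False by (auto intro: mult_left_mono)
  qed
  finally show ?case .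
qed

definition potential :: "nat \<Rightarrow> nat \<Rightarrow> nat \<Rightarrow> nat \<Rightarrow> nat \<Rightarrow> mat \<Rightarrow> real" where
  "potential N n m w h A = (\<Sum>L\<in>layers n w h. occ N n m L A)"

lemma potential_nonneg: "0 \<le> potential N n m w h A"
  by (simp add: potential_def sum_nonneg occ_nonneg)

lemma occ_single:
  assumes "1 \<le> m" "bad_event N W A"
  shows "occ N n m (replicate h {} @ [{W}]) A = 1"
  using assms by (induction h) auto

text \<open>\<open>put W {}\<close> embeds the witnesses of the next stage into those with one more
  layer. Its image misses the witness \<open>?S\<close>, in which \<open>W\<close> alone explains
  the present step; that one has \<open>occ\<close> equal to 1 and yields the gain.\<close>

lemma potential_step:
  assumes "1 \<le> m" "1 \<le> w" "W \<in> bad_sets N n w A"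
  shows "1 + mean (mats N n m) (\<lambda>B. potential N n m w h (override_on A B (UNIV \<times> W)))
    \<le> potential N n m w (Suc h) A"
proof -
  let ?S = "replicate (Suc h) {} @ [{W}]"
  have W: "W \<in> col_sets n w" "bad_event N W A" "W \<noteq> {}"
    using assms by (auto simp: bad_sets_def col_sets_def)
  have nm: "\<not> meets W {}" by (simp add: meets_def)
  have inj: "inj_on (put W {}) (layers n w h)"
    using unput_put[OF W(3) nm] by (metis inj_onI list.inject)
  have sub: "put W {} ` layers n w h \<subseteq> layers n w (Suc h)"
    using put_layers[OF W(1) _ nm] by (auto simp: layers_Suc_iff)
  have notin: "?S \<notin> put W {} ` layers n w h"
    using put_neq_single[OF W(3) layers_not_Nil, of _ n w h "{}" "Suc h"] by (metis imageE)
  \<comment> \<open>An empty leading layer imposes no condition and resamples nothing, so it is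
    free; it serves as the layer not meeting \<open>W\<close> that \<open>put\<close> starts
    from.\<close>
  have "mean (mats N n m) (\<lambda>B. potential N n m w h (override_on A B (UNIV \<times> W)))
      = (\<Sum>L\<in>layers n w h. mean (mats N n m) (\<lambda>B. occ N n m ({} # L) (override_on A B (UNIV \<times> W))))"
    using assms(1) by (simp add: potential_def mean_sum override_on_def)
  also have "\<dots> \<le> (\<Sum>L\<in>layers n w h. occ N n m (put W {} L) A)"
    by (intro sum_mono occ_put assms W nm)
  also have "\<dots> = (\<Sum>L\<in>put W {} ` layers n w h. occ N n m L A)"
    by (simp add: sum.reindex[OF inj])
  finally have "1 + mean (mats N n m) (\<lambda>B. potential N n m w h (override_on A B (UNIV \<times> W)))
      \<le> (\<Sum>L\<in>insert ?S (put W {} ` layers n w h). occ N n m L A)"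
    using notin occ_single[OF assms(1) W(2), of n "Suc h"] by (simp del: replicate_Suc)
  also have "\<dots> \<le> potential N n m w (Suc h) A"
    unfolding potential_def using sub single_layers[OF W(1), of "Suc h"]
    by (intro sum_mono2) (auto simp: occ_nonneg simp del: replicate_Suc)
  finally show ?thesis .
qed

section \<open>Mean of the potential of a uniform random matrix\<close>

lemma mean_bad_family:
  assumes "1 \<le> m" "finite I" "pairwise disjnt I"
    "\<And>V. V \<in> I \<Longrightarrow> mean (mats N n m) (\<lambda>A. of_bool (bad_event N V A)) = p"
  shows "mean (mats N n m) (\<lambda>A. of_bool (\<forall>V\<in>I. bad_event N V A)) = p ^ card I"
  using assms(2-)
proof (induction I)
  case empty
  then show ?case using assms(1) by simp
next
  case (insert W I)
  let ?M = "mats N n m"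
  have W: "\<not> meets W I"
    using insert.prems(1) insert.hyps(2) by (auto simp: pairwise_insert meets_def disjnt_def)
  have "mean ?M (\<lambda>A. of_bool (\<forall>V\<in>insert W I. bad_event N V A))
      = mean ?M (\<lambda>A. of_bool (bad_event N W A) * of_bool (\<forall>V\<in>I. bad_event N V A))"
    by (simp add: of_bool_conj)
  \<comment> \<open>The family \<open>I\<close> ignores the columns of \<open>W\<close>, so a
    resampling of \<open>W\<close> can be inserted in order to factor the expectation.\<close>
  also have "\<dots> = mean ?M (\<lambda>A. of_bool (bad_event N W A)
      * mean ?M (\<lambda>B. of_bool (\<forall>V\<in>I. bad_event N V (override_on A B (UNIV \<times> W)))))"
    using assms(1) by (simp only: bad_family_override_disjoint[OF W] mean_const finite_mats
        mats_not_empty not_False_eq_True)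
  also have "\<dots> = mean ?M (\<lambda>A. of_bool (bad_event N W A)) * mean ?M (\<lambda>A. of_bool (\<forall>V\<in>I. bad_event N V A))"
    unfolding mats_def by (rule mean_resample_mult) (simp add: bad_event_override_subset)
  also have "\<dots> = p ^ card (insert W I)"
    using insert by (simp add: pairwise_insert)
  finally show ?case .
qed

text \<open>Each layer's condition depends only on columns that are resampled right afterwards, so
  the later layers see an independent uniform matrix.\<close>

lemma mean_occ:
  assumes "1 \<le> m" "\<And>I. I \<in> set L \<Longrightarrow> I \<subseteq> F \<and> pairwise disjnt I" "finite F"
    "\<And>V. V \<in> F \<Longrightarrow> mean (mats N n m) (\<lambda>A. of_bool (bad_event N V A)) = p"
  shows "mean (mats N n m) (occ N n m L) = p ^ sum_list (map card L)"
  using assms(2)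
proof (induction L)
  case Nil
  then show ?case using assms(1) by simp
next
  case (Cons I L)
  let ?M = "mats N n m"
  have I: "finite I" "I \<subseteq> F" "pairwise disjnt I"
    using Cons.prems[of I] assms(3) finite_subset by auto
  have "mean ?M (occ N n m (I # L)) = mean ?M (\<lambda>A. of_bool (\<forall>V\<in>I. bad_event N V A)) * mean ?M (occ N n m L)"
    unfolding occ.simps mats_def
    by (rule mean_resample_mult)
      (use bad_event_override_subset[OF Union_upper] in \<open>auto intro!: arg_cong[where f = of_bool]\<close>)
  also have "mean ?M (\<lambda>A. of_bool (\<forall>V\<in>I. bad_event N V A)) = p ^ card I"
    using I(2) assms(4) by (intro mean_bad_family[OF assms(1) I(1,3)]) auto
  also have "p ^ card I * mean ?M (occ N n m L) = p ^ sum_list (map card (I # L))"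
    using Cons by (simp add: power_add)
  finally show ?case .
qed

text \<open>The sum over all neighbouring families is submultiplicative because \<open>J\<close> is determined by
  its part meeting \<open>V\<close> and its part not meeting \<open>V\<close>, which must meet \<open>I - {V}\<close>.\<close>

lemma nbr_families_submultiplicative:
  fixes \<mu> :: real
  assumes "finite I" "0 \<le> \<mu>" "\<And>V. V \<in> I \<Longrightarrow> (\<Sum>J\<in>nbr_families n w {V}. \<mu> ^ card J) \<le> c"
  shows "(\<Sum>J\<in>nbr_families n w I. \<mu> ^ card J) \<le> c ^ card I"
  using assms(1,3)
proof (induction I)
  case empty
  have "nbr_families n w {} = {{}}" by (auto simp: nbr_families_def meets_def)
  then show ?case by simp
next
  case (insert V I)
  let ?S = "\<lambda>I. nbr_families n w I"
  define s where "s = (\<lambda>J. ({U \<in> J. U \<inter> V \<noteq> {}}, {U \<in> J. U \<inter> V = {}}))"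
  have J: "J = fst (s J) \<union> snd (s J)" "fst (s J) \<inter> snd (s J) = {}" for J
    by (auto simp: s_def)
  have inj: "inj_on s (?S (insert V I))"
    using J(1) by (metis inj_onI)
  have sub: "s J \<in> ?S {V} \<times> ?S I" if "J \<in> ?S (insert V I)" for J
  proof -
    have "pairwise disjnt {U \<in> J. U \<inter> V \<noteq> {}}" "pairwise disjnt {U \<in> J. U \<inter> V = {}}"
      using that by (auto simp: nbr_families_def intro: pairwise_subset)
    then show ?thesis
      using that by (auto simp: s_def nbr_families_def meets_def Int_commute)
  qed
  have card: "\<mu> ^ card J = \<mu> ^ card (fst (s J)) * \<mu> ^ card (snd (s J))" if "J \<in> ?S (insert V I)" for J
  proof -
    have "finite J" using that finite_subset[OF _ finite_col_sets] by (auto simp: nbr_families_def)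
    then have "card J = card (fst (s J)) + card (snd (s J))"
      by (metis J card_Un_disjoint finite_Un)
    then show ?thesis by (simp add: power_add)
  qed
  have "(\<Sum>J\<in>?S (insert V I). \<mu> ^ card J) = (\<Sum>J\<in>?S (insert V I). \<mu> ^ card (fst (s J)) * \<mu> ^ card (snd (s J)))"
    by (intro sum.cong card refl)
  also have "\<dots> = (\<Sum>z\<in>s ` ?S (insert V I). \<mu> ^ card (fst z) * \<mu> ^ card (snd z))"
    by (simp add: sum.reindex[OF inj])
  \<comment> \<open>Only an inequality: a pair of families need not have a pairwise disjoint
    union.\<close>
  also have "\<dots> \<le> (\<Sum>z\<in>?S {V} \<times> ?S I. \<mu> ^ card (fst z) * \<mu> ^ card (snd z))"
    using sub assms(2) by (intro sum_mono2 image_subsetI) auto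
  also have "\<dots> = (\<Sum>J\<in>?S {V}. \<mu> ^ card J) * (\<Sum>J\<in>?S I. \<mu> ^ card J)"
    by (simp add: sum_product sum.cartesian_product case_prod_unfold)
  also have "\<dots> \<le> c * c ^ card I"
    using insert assms(2) order_trans[OF sum_nonneg insert.prems[of V]]
    by (intro mult_mono insert.prems insert.IH) (auto intro!: sum_nonneg)
  finally show ?case using insert.hyps by simp
qed

lemma sum_layers_Suc:
  "(\<Sum>L\<in>layers n w (Suc h). f L) = (\<Sum>L\<in>layers n w h. \<Sum>J\<in>nbr_families n w (hd L). f (J # L))"
proof -
  have "layers n w (Suc h) = (\<lambda>(L, J). J # L) ` (SIGMA L:layers n w h. nbr_families n w (hd L))"
    by (force simp: layers.simps)
  moreover have "inj_on (\<lambda>(L, J). J # L) (SIGMA L:layers n w h. nbr_families n w (hd L))"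
    by (auto intro!: inj_onI)
  ultimately have "(\<Sum>L\<in>layers n w (Suc h). f L)
      = (\<Sum>(L, J)\<in>(SIGMA L:layers n w h. nbr_families n w (hd L)). f (J # L))"
    by (simp add: sum.reindex case_prod_unfold)
  then show ?thesis by (simp add: sum.Sigma)
qed

text \<open>Weighting the outermost layer by \<open>\<mu>\<close> instead of \<open>p\<close> makes the total weight nonincreasing
  in the number of layers.\<close>

lemma sum_layers_le:
  fixes \<mu> p :: real
  assumes "0 < p" "p \<le> \<mu>"
    "\<And>V. V \<in> col_sets n w \<Longrightarrow> p * (\<Sum>J\<in>nbr_families n w {V}. \<mu> ^ card J) \<le> \<mu>"
  shows "(\<Sum>L\<in>layers n w h. p ^ sum_list (map card L)) \<le> (n choose w) * \<mu>"
proof -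
  \<comment> \<open>The condition for a single set, in the form that the sum is at most
    \<open>\<mu> / p\<close>, is lifted to a whole layer by submultiplicativity.\<close>
  have inner: "p ^ card I * (\<Sum>J\<in>nbr_families n w I. \<mu> ^ card J) \<le> \<mu> ^ card I"
    if "I \<subseteq> col_sets n w" for I
  proof -
    have "(\<Sum>J\<in>nbr_families n w I. \<mu> ^ card J) \<le> (\<mu> / p) ^ card I"
      using that assms finite_subset[OF that]
      by (intro nbr_families_submultiplicative) (auto simp: field_simps subset_iff)
    then show ?thesis using assms(1) by (simp add: field_simps)
  qed
  have "(\<Sum>L\<in>layers n w h. \<mu> ^ card (hd L) * p ^ sum_list (map card (tl L))) \<le> (n choose w) * \<mu>"
  proof (induction h)
    case 0
    have "inj_on (\<lambda>W. [{W}]) (col_sets n w)" by (auto intro: inj_onI)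
    then show ?case by (simp add: sum.reindex card_col_sets)
  next
    case (Suc h)
    have "(\<Sum>L\<in>layers n w (Suc h). \<mu> ^ card (hd L) * p ^ sum_list (map card (tl L)))
       = (\<Sum>L\<in>layers n w h. (\<Sum>J\<in>nbr_families n w (hd L). \<mu> ^ card J) * p ^ sum_list (map card L))"
      by (simp add: sum_layers_Suc sum_distrib_right)
    also have "\<dots> \<le> (\<Sum>L\<in>layers n w h. \<mu> ^ card (hd L) * p ^ sum_list (map card (tl L)))"
    proof (rule sum_mono)
      fix L assume L: "L \<in> layers n w h"
      then obtain I K where IK: "L = I # K" using layers_not_Nil by (meson neq_Nil_conv)
      have "I \<subseteq> col_sets n w" using layers_families[OF L, of I] IK by simp
      from mult_right_mono[OF inner[OF this], of "p ^ sum_list (map card K)"] assms(1)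
      show "(\<Sum>J\<in>nbr_families n w (hd L). \<mu> ^ card J) * p ^ sum_list (map card L)
          \<le> \<mu> ^ card (hd L) * p ^ sum_list (map card (tl L))"
        by (simp add: IK power_add mult_ac)
    qed
    finally show ?case using Suc.IH by simp
  qed
  \<comment> \<open>Here \<open>p \<le> \<mu>\<close> returns from the modified weight of the
    outermost layer to the true one.\<close>
  moreover have "p ^ sum_list (map card L) \<le> \<mu> ^ card (hd L) * p ^ sum_list (map card (tl L))"
    if "L \<in> layers n w h" for L
    using layers_not_Nil[OF that] assms(1,2)
    by (cases L) (auto simp: power_add intro!: mult_right_mono power_mono)
  ultimately show ?thesis by (meson order_trans sum_mono)
qed

text \<open>The bound does not depend on the number \<open>h\<close> of layers, so it serves runs of
  every length.\<close>

lemma mean_potential_le: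
  fixes \<mu> p :: real
  assumes "1 \<le> m" "0 < p" "p \<le> \<mu>"
    "\<And>V. V \<in> col_sets n w \<Longrightarrow> p * (\<Sum>J\<in>nbr_families n w {V}. \<mu> ^ card J) \<le> \<mu>"
    "\<And>V. V \<in> col_sets n w \<Longrightarrow> mean (mats N n m) (\<lambda>A. of_bool (bad_event N V A)) = p"
  shows "mean (mats N n m) (potential N n m w h) \<le> (n choose w) * \<mu>"
proof -
  have "mean (mats N n m) (potential N n m w h) = (\<Sum>L\<in>layers n w h. mean (mats N n m) (occ N n m L))"
    unfolding potential_def by (rule mean_sum)
  also have "\<dots> = (\<Sum>L\<in>layers n w h. p ^ sum_list (map card L))"
    by (intro sum.cong refl mean_occ[where F = "col_sets n w"] assms finite_col_sets layers_families)
  also have "\<dots> \<le> (n choose w) * \<mu>"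
    using assms by (intro sum_layers_le)
  finally show ?thesis .
qed

section \<open>Counting families of disjoint sets\<close>

text \<open>The falling factorial. Truncated subtraction makes it vanish for \<open>a < r\<close>,
  which takes care of configurations that do not fit.\<close>

definition ff :: "nat \<Rightarrow> nat \<Rightarrow> nat" where
  "ff a r = (\<Prod>t<r. a - t)"

lemma ff_0 [simp]: "ff a 0 = 1"
  by (simp add: ff_def)

lemma ff_Suc: "ff a (Suc r) = ff a r * (a - r)"
  by (simp add: ff_def)

lemma ff_add: "ff a (x + y) = ff a x * ff (a - x) y"
  by (induction y) (simp_all add: ff_Suc)

lemma ff_eq_0_iff: "ff a r = 0 \<longleftrightarrow> a < r"
  by (auto simp: ff_def)

lemma ff_binomial: "ff a r = fact r * (a choose r)"
proof (induction r arbitrary: a)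
  case (Suc r)
  have "ff a (Suc r) = a * ff (a - 1) r"
    using ff_add[of a 1 r] by (simp add: ff_Suc)
  also have "\<dots> = fact r * (a * ((a - 1) choose r))"
    using Suc by simp
  also have "a * ((a - 1) choose r) = Suc r * (a choose Suc r)"
    using Suc_times_binomial_eq[of "a - 1" r] by (cases a) (auto simp: mult_ac)
  finally show ?case by (simp add: algebra_simps)
qed simp

text \<open>The factor \<open>t = 0\<close> is a bare \<open>b\<close>, so the product starts at 1.
  For \<open>r > b\<close> both sides vanish, the right one through \<open>l = b\<close>.\<close>

lemma ff_real:
  assumes "0 < b"
  shows "real (ff b r) = real b ^ r * (\<Prod>l = 1..r - 1. 1 - real l / real b)"
proof (induction r)
  case (Suc r)
  show ?case
  proof (cases r)
    case (Suc r')
    have "real (ff b (Suc r)) = real (ff b r) * (real b - real r)"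
      using ff_eq_0_iff[of b r] by (cases "r \<le> b") (auto simp: ff_Suc of_nat_diff)
    also have "\<dots> = real (ff b r) * (real b * (1 - real r / real b))"
      using assms by (simp add: field_simps)
    finally show ?thesis
      using Suc.IH Suc by simp
  qed (simp add: ff_Suc)
qed simp

text \<open>Arbitrary \<open>X\<close> and \<open>Y\<close> instead of a column set and its
  complement, because removing a member \<open>V\<close> leads to \<open>X - V\<close> and
  \<open>Y - V\<close>.\<close>

definition touching_families :: "nat \<Rightarrow> 'a set \<Rightarrow> 'a set \<Rightarrow> nat \<Rightarrow> 'a set set set" where
  "touching_families w X Y k = {J. finite J \<and> card J = k \<and> pairwise disjnt J \<and>
     (\<forall>V\<in>J. V \<subseteq> X \<union> Y \<and> card V = w \<and> V \<inter> X \<noteq> {})}"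

lemma finite_touching_families:
  "finite X \<Longrightarrow> finite Y \<Longrightarrow> finite (touching_families w X Y k)"
  by (rule finite_subset[of _ "Pow (Pow (X \<union> Y))"]) (auto simp: touching_families_def)

lemma touching_families_0: "touching_families w X Y 0 = {{}}"
  by (auto simp: touching_families_def)

text \<open>Double counting of pairs of a family and one of its members. By disjointness, the other
  members avoid \<open>V\<close> and thus touch \<open>X - V\<close>.\<close>

lemma card_touching_families_Suc:
  fixes w :: nat and X Y :: "'a set"
  assumes "finite X" "finite Y"
  defines "U \<equiv> {V. V \<subseteq> X \<union> Y \<and> card V = w \<and> V \<inter> X \<noteq> {}}"
  shows "Suc k * card (touching_families w X Y (Suc k))
    = (\<Sum>V\<in>U. card (touching_families w (X - V) (Y - V) k))"
proof -
  let ?F = "touching_families w X Y (Suc k)" and ?G = "\<lambda>V. touching_families w (X - V) (Y - V) k"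
  have finU: "finite U"
    by (rule finite_subset[of _ "Pow (X \<union> Y)"]) (use assms in auto)
  have fwd: "V \<in> U \<and> J - {V} \<in> ?G V" if "J \<in> ?F" "V \<in> J" for J V
  proof -
    have "V' \<inter> V = {}" if "V' \<in> J - {V}" for V'
      using \<open>J \<in> ?F\<close> \<open>V \<in> J\<close> that by (auto simp: touching_families_def pairwise_def disjnt_def)
    then have "V' \<subseteq> (X - V) \<union> (Y - V) \<and> card V' = w \<and> V' \<inter> (X - V) \<noteq> {}" if "V' \<in> J - {V}" for V'
      using \<open>J \<in> ?F\<close> that unfolding touching_families_def by blast
    moreover have "pairwise disjnt (J - {V})"
      using that(1) by (auto simp: touching_families_def intro: pairwise_subset)
    ultimately show ?thesis
      using that unfolding touching_families_def U_def by simp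
  qed
  have bwd: "V \<notin> J \<and> insert V J \<in> ?F" if "V \<in> U" "J \<in> ?G V" for J V
  proof -
    have sub: "\<And>V'. V' \<in> J \<Longrightarrow> V' \<inter> V = {}" and "V \<noteq> {}"
      using that unfolding touching_families_def U_def by blast+
    then have nin: "V \<notin> J" by blast
    have pw: "pairwise disjnt (insert V J)"
      using that(2) sub by (auto simp: touching_families_def pairwise_insert disjnt_def)
    have mem: "\<forall>V'\<in>insert V J. V' \<subseteq> X \<union> Y \<and> card V' = w \<and> V' \<inter> X \<noteq> {}"
      using that unfolding touching_families_def U_def by blast
    have "finite J" "card J = k"
      using that(2) by (simp_all add: touching_families_def)
    then have "insert V J \<in> ?F"
      unfolding touching_families_def by (intro CollectI conjI mem pw) (use nin in simp_all)
    with nin show ?thesis by blast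
  qed
  have "bij_betw (\<lambda>(J, V). (V, J - {V})) (SIGMA J:?F. J) (SIGMA V:U. ?G V)"
  proof (rule bij_betw_byWitness[where f' = "\<lambda>(V, J). (insert V J, V)"])
    show "\<forall>z\<in>SIGMA J:?F. J. (\<lambda>(V, J). (insert V J, V)) ((\<lambda>(J, V). (V, J - {V})) z) = z"
      by (auto simp only: insert_Diff split: prod.splits)
    show "\<forall>z\<in>SIGMA V:U. ?G V. (\<lambda>(J, V). (V, J - {V})) ((\<lambda>(V, J). (insert V J, V)) z) = z"
      using bwd by simp
    show "(\<lambda>(J, V). (V, J - {V})) ` (SIGMA J:?F. J) \<subseteq> (SIGMA V:U. ?G V)"
    proof (rule image_subsetI)
      fix z assume "z \<in> (SIGMA J:?F. J)"
      then obtain J V where "z = (J, V)" "J \<in> ?F" "V \<in> J" by (elim SigmaE)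
      then show "(\<lambda>(J, V). (V, J - {V})) z \<in> (SIGMA V:U. ?G V)" using fwd[of J V] by simp
    qed
    show "(\<lambda>(V, J). (insert V J, V)) ` (SIGMA V:U. ?G V) \<subseteq> (SIGMA J:?F. J)"
    proof (rule image_subsetI)
      fix z assume "z \<in> (SIGMA V:U. ?G V)"
      then obtain V J where "z = (V, J)" "V \<in> U" "J \<in> ?G V" by (elim SigmaE)
      then show "(\<lambda>(V, J). (insert V J, V)) z \<in> (SIGMA J:?F. J)" using bwd[of V J] by simp
    qed
  qed
  then have "card (SIGMA J:?F. J) = card (SIGMA V:U. ?G V)"
    by (rule bij_betw_same_card)
  moreover have "card (SIGMA J:?F. J) = (\<Sum>J\<in>?F. card J)"
    by (rule card_SigmaI) (use assms finite_touching_families in \<open>auto simp: touching_families_def\<close>)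
  moreover have "(\<Sum>J\<in>?F. card J) = Suc k * card ?F"
    by (simp add: touching_families_def)
  moreover have "card (SIGMA V:U. ?G V) = (\<Sum>V\<in>U. card (?G V))"
    using finU assms(1,2) finite_touching_families[of "X - _" "Y - _"] by (intro card_SigmaI) simp_all
  ultimately show ?thesis by simp
qed

text \<open>\<open>V\<close> is split into its part in \<open>X\<close>, of size
  \<open>i + 1\<close>, and its part in \<open>Y\<close>. The shift by one expresses that
  \<open>V\<close> meets \<open>X\<close>, and this \<open>i\<close> becomes an index of the inner
  sum in \<open>Gamma_tilde\<close>.\<close>

lemma sum_over_touching_sets:
  fixes g :: "nat \<Rightarrow> nat \<Rightarrow> real"
  assumes "finite X" "finite Y" "X \<inter> Y = {}" "1 \<le> w"
  shows "(\<Sum>V | V \<subseteq> X \<union> Y \<and> card V = w \<and> V \<inter> X \<noteq> {}. g (card (X - V)) (card (Y - V)))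
    = (\<Sum>i = 0..w - 1. real (card X choose Suc i) * real (card Y choose (w - 1 - i))
         * g (card X - Suc i) (card Y - (w - 1 - i)))"
proof -
  let ?U = "{V. V \<subseteq> X \<union> Y \<and> card V = w \<and> V \<inter> X \<noteq> {}}"
  let ?P = "\<lambda>i. {A. A \<subseteq> X \<and> card A = Suc i} \<times> {B. B \<subseteq> Y \<and> card B = w - 1 - i}"
  have fin: "finite {A. A \<subseteq> X \<and> card A = k}" "finite {A. A \<subseteq> Y \<and> card A = k}" for k
    using assms by auto
  have cV: "card V = card (V \<inter> X) + card (V \<inter> Y)" if "V \<subseteq> X \<union> Y" for V
  proof -
    have "V = (V \<inter> X) \<union> (V \<inter> Y)" "(V \<inter> X) \<inter> (V \<inter> Y) = {}" using that assms(3) by auto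
    then show ?thesis using assms(1,2) by (metis card_Un_disjoint finite_Int)
  qed
  have pos: "0 < card (V \<inter> X)" if "V \<inter> X \<noteq> {}" for V
    using that assms(1) by (simp add: card_gt_0_iff)
  have bij: "bij_betw (\<lambda>V. (card (V \<inter> X) - 1, (V \<inter> X, V \<inter> Y))) ?U (SIGMA i:{0..w-1}. ?P i)"
  proof (rule bij_betw_byWitness[where f' = "\<lambda>(i, (A, B)). A \<union> B"])
    show "(\<lambda>V. (card (V \<inter> X) - 1, (V \<inter> X, V \<inter> Y))) ` ?U \<subseteq> (SIGMA i:{0..w-1}. ?P i)"
    proof (rule image_subsetI)
      fix V assume V: "V \<in> ?U"
      then have "w = card (V \<inter> X) + card (V \<inter> Y)" "0 < card (V \<inter> X)" using cV[of V] pos[of V] by auto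
      then show "(card (V \<inter> X) - 1, (V \<inter> X, V \<inter> Y)) \<in> (SIGMA i:{0..w-1}. ?P i)" by auto
    qed
    have AB: "(A \<union> B) \<inter> X = A" "(A \<union> B) \<inter> Y = B" if "A \<subseteq> X" "B \<subseteq> Y" for A B
      using that assms(3) by auto
    show "\<forall>z\<in>SIGMA i:{0..w-1}. ?P i.
        (\<lambda>V. (card (V \<inter> X) - 1, (V \<inter> X, V \<inter> Y))) ((\<lambda>(i, (A, B)). A \<union> B) z) = z"
      using AB by auto
    show "(\<lambda>(i, (A, B)). A \<union> B) ` (SIGMA i:{0..w-1}. ?P i) \<subseteq> ?U"
    proof (clarsimp, intro conjI)
      fix i A B assume *: "i \<le> w - Suc 0" "A \<subseteq> X" "card A = Suc i" "B \<subseteq> Y" "card B = w - Suc i"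
      show "A \<subseteq> X \<union> Y" "B \<subseteq> X \<union> Y" using * by auto
      have "card (A \<union> B) = card A + card B"
        using AB[OF *(2,4)] cV[of "A \<union> B"] * by auto
      then show "card (A \<union> B) = w" using * assms(4) by simp
      show "(A \<union> B) \<inter> X \<noteq> {}" using AB(1)[OF *(2,4)] *(3) by auto
    qed
  qed auto
  have "(\<Sum>V\<in>?U. g (card (X - V)) (card (Y - V)))
      = (\<Sum>V\<in>?U. (\<lambda>(i, (A, B)). g (card X - Suc i) (card Y - (w - 1 - i)))
          (card (V \<inter> X) - 1, (V \<inter> X, V \<inter> Y)))"
  proof (rule sum.cong[OF refl])
    fix V assume V: "V \<in> ?U"
    then have "w = card (V \<inter> X) + card (V \<inter> Y)" "0 < card (V \<inter> X)" using cV[of V] pos[of V] by auto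
    moreover have "card (X - V) = card X - card (V \<inter> X)" "card (Y - V) = card Y - card (V \<inter> Y)"
      using assms by (simp_all add: card_Diff_subset_Int Int_commute)
    ultimately show "g (card (X - V)) (card (Y - V)) = (\<lambda>(i, (A, B)). g (card X - Suc i) (card Y - (w - 1 - i)))
          (card (V \<inter> X) - 1, (V \<inter> X, V \<inter> Y))" by simp
  qed
  also have "\<dots> = (\<Sum>z\<in>(SIGMA i:{0..w-1}. ?P i). (\<lambda>(i, (A, B)). g (card X - Suc i) (card Y - (w - 1 - i))) z)"
    by (rule sum.reindex_bij_betw[OF bij])
  also have "\<dots> = (\<Sum>i = 0..w - 1. \<Sum>z\<in>?P i. g (card X - Suc i) (card Y - (w - 1 - i)))"
    using fin by (subst sum.Sigma) (auto intro!: sum.cong)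
  also have "\<dots> = (\<Sum>i = 0..w - 1. real (card X choose Suc i) * real (card Y choose (w - 1 - i))
         * g (card X - Suc i) (card Y - (w - 1 - i)))"
    using n_subsets[OF assms(1)] n_subsets[OF assms(2)] by (simp add: card_cartesian_product)
  finally show ?thesis .
qed

text \<open>For \<open>i l \<le> w - 1\<close>, the number of ordered \<open>k\<close>-tuples of
  disjoint \<open>w\<close>-sets whose \<open>l\<close>-th member takes \<open>i l + 1\<close>
  elements from a set of size \<open>a\<close> and the others from a disjoint set of size
  \<open>b\<close>.\<close>

definition tuple_weight :: "nat \<Rightarrow> nat \<Rightarrow> nat \<Rightarrow> nat \<Rightarrow> (nat \<Rightarrow> nat) \<Rightarrow> real" where
  "tuple_weight w k a b i = ff a (\<Sum>l = 1..k. Suc (i l)) * ff b (\<Sum>l = 1..k. w - 1 - i l)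
     / (\<Prod>l = 1..k. fact (Suc (i l)) * fact (w - 1 - i l))"

text \<open>The factor \<open>fact k\<close> passes from families to ordered tuples. In the
  induction the removed member supplies the entry at \<open>Suc k\<close>, and \<open>ff_add\<close>
  removes its elements from \<open>X\<close> and \<open>Y\<close>.\<close>

lemma card_touching_families:
  assumes "finite X" "finite Y" "X \<inter> Y = {}" "1 \<le> w"
  shows "fact k * real (card (touching_families w X Y k))
    = (\<Sum>i\<in>{1..k} \<rightarrow>\<^sub>E {0..w - 1}. tuple_weight w k (card X) (card Y) i)"
  using assms(1-3)
proof (induction k arbitrary: X Y)
  case 0
  then show ?case by (simp add: touching_families_0 tuple_weight_def)
next
  case (Suc k)
  let ?T = "{0..w - 1}" and ?a = "card X" and ?b = "card Y"
  define g where "g a b = (\<Sum>i\<in>{1..k} \<rightarrow>\<^sub>E ?T. tuple_weight w k a b i)" for a b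
  have "fact (Suc k) * real (card (touching_families w X Y (Suc k)))
      = fact k * real (Suc k * card (touching_families w X Y (Suc k)))"
    by (simp add: algebra_simps)
  also have "\<dots> = (\<Sum>V | V \<subseteq> X \<union> Y \<and> card V = w \<and> V \<inter> X \<noteq> {}.
      fact k * real (card (touching_families w (X - V) (Y - V) k)))"
    by (simp only: card_touching_families_Suc[OF Suc.prems(1,2)] of_nat_sum sum_distrib_left)
  also have "\<dots> = (\<Sum>V | V \<subseteq> X \<union> Y \<and> card V = w \<and> V \<inter> X \<noteq> {}. g (card (X - V)) (card (Y - V)))"
    unfolding g_def using Suc.prems by (intro sum.cong refl Suc.IH) auto
  also have "\<dots> = (\<Sum>y = 0..w - 1. real (?a choose Suc y) * real (?b choose (w - 1 - y))
         * g (?a - Suc y) (?b - (w - 1 - y)))"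
    by (rule sum_over_touching_sets[OF Suc.prems assms(4)])
  also have "\<dots> = (\<Sum>y\<in>?T. \<Sum>i\<in>{1..k} \<rightarrow>\<^sub>E ?T. tuple_weight w (Suc k) ?a ?b (i(Suc k := y)))"
  proof (rule sum.cong[OF refl])
    fix y
    have "real (?a choose Suc y) * real (?b choose (w - 1 - y)) * tuple_weight w k (?a - Suc y) (?b - (w - 1 - y)) i
        = tuple_weight w (Suc k) ?a ?b (i(Suc k := y))" for i
    proof -
      have e1: "(\<Sum>l = 1..Suc k. Suc ((i(Suc k := y)) l)) = Suc y + (\<Sum>l = 1..k. Suc (i l))"
        and e2: "(\<Sum>l = 1..Suc k. w - 1 - (i(Suc k := y)) l) = (w - 1 - y) + (\<Sum>l = 1..k. w - 1 - i l)"
        by (auto intro!: sum.cong)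
      have e3: "(\<Prod>l = 1..Suc k. fact (Suc ((i(Suc k := y)) l)) * fact (w - 1 - (i(Suc k := y)) l) :: real)
          = (\<Prod>l = 1..k. fact (Suc (i l)) * fact (w - 1 - i l)) * (fact (Suc y) * fact (w - 1 - y))"
        by (auto intro!: prod.cong)
      show ?thesis
        unfolding tuple_weight_def e1 e2 e3 ff_add ff_binomial[of ?a "Suc y"] ff_binomial[of ?b "w - 1 - y"]
        by (simp add: mult_ac del: fact_Suc)
    qed
    then show "real (?a choose Suc y) * real (?b choose (w - 1 - y)) * g (?a - Suc y) (?b - (w - 1 - y))
      = (\<Sum>i\<in>{1..k} \<rightarrow>\<^sub>E ?T. tuple_weight w (Suc k) ?a ?b (i(Suc k := y)))"
      by (simp add: g_def sum_distrib_left)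
  qed
  also have "\<dots> = (\<Sum>i\<in>{1..Suc k} \<rightarrow>\<^sub>E ?T. tuple_weight w (Suc k) ?a ?b i)"
  proof -
    have "{1..Suc k} \<rightarrow>\<^sub>E ?T = (\<lambda>(y, g). g(Suc k := y)) ` (?T \<times> ({1..k} \<rightarrow>\<^sub>E ?T))"
      by (simp add: atLeastAtMostSuc_conv PiE_insert_eq)
    moreover have "inj_on (\<lambda>(y, g). g(Suc k := y)) (?T \<times> ({1..k} \<rightarrow>\<^sub>E ?T))"
      using inj_combinator[of "Suc k" "{1..k}" "\<lambda>_. ?T"] by simp
    ultimately show ?thesis
      by (simp add: sum.reindex sum.cartesian_product case_prod_unfold)
  qed
  finally show ?case .
qed

text \<open>The quotient of \<open>fact (w - 1)\<close> by \<open>fact (w - 1 - i)\<close> is a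
  falling factorial, and extracting \<open>w ^ i\<close> from it leaves the product over
  \<open>1 - s / w\<close> in \<open>Gamma_tilde\<close>.\<close>

lemma inverse_fact_split:
  assumes "1 \<le> w" "i \<le> w - 1"
  shows "1 / (fact (Suc i) * fact (w - 1 - i) :: real)
    = real w ^ i / fact (w - 1) * (1 / fact i * (1 / (real i + 1) * (\<Prod>s = 1..i. 1 - real s / real w)))"
proof -
  have "fact (w - 1) = fact (w - 1 - i) * ff (w - 1) i"
    using ff_add[of "w - 1" i "w - 1 - i", unfolded le_add_diff_inverse[OF assms(2)]] ff_binomial[of "w - 1" "w - 1"]
      ff_binomial[of "w - 1 - i" "w - 1 - i"] by (simp add: mult.commute)
  then have f: "(fact (w - 1) :: real) = fact (w - 1 - i) * real (ff (w - 1) i)"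
    by (metis of_nat_fact of_nat_mult)
  define P where "P = (\<Prod>s = 1..i. 1 - real s / real w)"
  have "real w * real (ff (w - 1) i) = real (ff w (Suc i))"
    using ff_add[of w 1 i] by (simp add: ff_Suc)
  also have "\<dots> = real w ^ Suc i * P"
    using ff_real[of w "Suc i"] assms(1) by (simp add: P_def)
  finally have g: "real (ff (w - 1) i) = real w ^ i * P"
    using assms(1) by simp
  have "real (ff (w - 1) i) \<noteq> 0"
    using ff_eq_0_iff[of "w - 1" i] assms(2) by simp
  then have "P \<noteq> 0" "real w ^ i \<noteq> 0"
    using g assms(1) by auto
  moreover have "(fact (Suc i) :: real) = fact i * (real i + 1)"
    by (simp add: algebra_simps)
  ultimately show ?thesis
    using assms(1) unfolding P_def[symmetric] f g by (auto simp: field_simps simp del: fact_Suc)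
qed

text \<open>\<open>ff w (k + j)\<close> splits into the two binomial coefficients. Of the powers of
  \<open>b\<close>, the part with exponent \<open>k * (w - 1)\<close> joins the \<open>k\<close>
  factors \<open>1 / fact (w - 1)\<close> in the scale, while the missing \<open>j\<close> powers
  pair with \<open>w ^ j\<close>.\<close>

lemma tuple_weight_eq:
  assumes "1 \<le> k" "k \<le> w" "0 < b" "i \<in> {1..k} \<rightarrow>\<^sub>E {0..w - 1}" "(\<Sum>l = 1..k. i l) = j" "j \<le> w - k"
  shows "tuple_weight w k w b i = fact k * real (w choose k) * (real b ^ (w - 1) / fact (w - 1)) ^ k
     * (real ((w - k) choose j) * (\<Prod>l = 1..k * (w - 1) - j - 1. 1 - real l / real b) * (real w / real b) ^ j
       * (fact j / (\<Prod>s = 1..k. fact (i s))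
           * (\<Prod>l = 1..k. 1 / (real (i l) + 1) * (\<Prod>s = 1..i l. 1 - real s / real w))))"
proof -
  have i: "i l \<le> w - 1" if "l \<in> {1..k}" for l
    using assms(4) that by auto
  have w: "1 \<le> w" using assms by simp
  have "(\<Sum>l = 1..k. w - 1 - i l) + (\<Sum>l = 1..k. i l) = (\<Sum>l = 1..k. w - 1)"
    unfolding sum.distrib[symmetric] by (intro sum.cong refl le_add_diff_inverse2 i)
  then have s2: "(\<Sum>l = 1..k. w - 1 - i l) = k * (w - 1) - j" and jle: "j \<le> k * (w - 1)"
    using assms(5) by auto
  have s1: "(\<Sum>l = 1..k. Suc (i l)) = k + j"
    using assms(5) by (simp add: sum.distrib[where g = i and h = "\<lambda>_. 1", simplified])
  have "ff w (k + j) = fact k * (w choose k) * (fact j * ((w - k) choose j))"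
    unfolding ff_add[of w k j] by (simp add: ff_binomial)
  then have n1: "real (ff w (k + j)) = fact k * real (w choose k) * (fact j * real ((w - k) choose j))"
    by simp
  have "real b ^ (k * (w - 1)) = real b ^ (k * (w - 1) - j) * real b ^ j"
    using jle by (simp add: power_add[symmetric])
  then have n2: "real (ff b (k * (w - 1) - j))
      = (real b ^ (w - 1)) ^ k / real b ^ j * (\<Prod>l = 1..k * (w - 1) - j - 1. 1 - real l / real b)"
    using assms(3) by (simp add: ff_real power_mult[symmetric] mult.commute)
  let ?P = "\<Prod>l = 1..k. 1 / (real (i l) + 1) * (\<Prod>s = 1..i l. 1 - real s / real w)"
  have "1 / (\<Prod>l = 1..k. fact (Suc (i l)) * fact (w - 1 - i l) :: real)
      = (\<Prod>l = 1..k. 1 / (fact (Suc (i l)) * fact (w - 1 - i l)))"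
    by (simp add: prod_dividef)
  also have "\<dots> = (\<Prod>l = 1..k. real w ^ i l / fact (w - 1)
      * (1 / fact (i l) * (1 / (real (i l) + 1) * (\<Prod>s = 1..i l. 1 - real s / real w))))"
    by (intro prod.cong refl inverse_fact_split w i)
  also have "\<dots> = real w ^ j / fact (w - 1) ^ k * (1 / (\<Prod>l = 1..k. fact (i l)) * ?P)"
    unfolding prod.distrib prod_dividef assms(5)[symmetric] power_sum by simp
  finally have n3: "1 / (\<Prod>l = 1..k. fact (Suc (i l)) * fact (w - 1 - i l) :: real)
      = real w ^ j / fact (w - 1) ^ k * (1 / (\<Prod>l = 1..k. fact (i l)) * ?P)" .
  have "tuple_weight w k w b i = real (ff w (k + j)) * real (ff b (k * (w - 1) - j))
      * (1 / (\<Prod>l = 1..k. fact (Suc (i l)) * fact (w - 1 - i l)))"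
    unfolding tuple_weight_def s1 s2 by simp
  then show ?thesis
    unfolding n1 n2 n3 power_divide by (simp add: mult_ac)
qed

text \<open>Such tuples need more than \<open>w\<close> elements inside or more than
  \<open>b\<close> outside, so one falling factorial vanishes. This is the origin of the ranges of
  \<open>j\<close> and \<open>k\<close> in \<open>Gamma_tilde\<close> and
  \<open>phi\<close>.\<close>

lemma tuple_weight_eq_0:
  assumes "i \<in> {1..k} \<rightarrow>\<^sub>E {0..w - 1}" "w - k < (\<Sum>l = 1..k. i l) \<or> w < k \<or> b + w < k * w"
  shows "tuple_weight w k w b i = 0"
proof -
  have i: "i l \<le> w - 1" if "l \<in> {1..k}" for l
    using assms(1) that by auto
  have s1: "(\<Sum>l = 1..k. Suc (i l)) = k + (\<Sum>l = 1..k. i l)"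
    by (simp add: sum.distrib[where g = i and h = "\<lambda>_. 1", simplified])
  have "(\<Sum>l = 1..k. w - 1 - i l) + (\<Sum>l = 1..k. i l) = (\<Sum>l = 1..k. w - 1)"
    unfolding sum.distrib[symmetric] by (intro sum.cong refl le_add_diff_inverse2 i)
  then have s2: "(\<Sum>l = 1..k. w - 1 - i l) + (\<Sum>l = 1..k. i l) = k * (w - 1)" by simp
  have "w < (\<Sum>l = 1..k. Suc (i l)) \<or> b < (\<Sum>l = 1..k. w - 1 - i l)"
    unfolding s1 using assms(2) s2 by (cases w) auto
  then show ?thesis
    using ff_eq_0_iff by (auto simp: tuple_weight_def)
qed

text \<open>Tuples are grouped by their sum \<open>j\<close>; only \<open>j \<le> w - k\<close>
  survives. No entry exceeds the sum, so the entry range \<open>{0..w - 1}\<close> can be replaced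
  by \<open>{0..j}\<close>.\<close>

lemma sum_tuple_weight:
  assumes "1 \<le> k" "k \<le> w" "w < n"
  shows "(\<Sum>i\<in>{1..k} \<rightarrow>\<^sub>E {0..w - 1}. tuple_weight w k w (n - w) i)
    = fact k * (real (w choose k) * Gamma_tilde k w n * (real (n - w) ^ (w - 1) / fact (w - 1)) ^ k)"
proof -
  let ?X = "{1..k} \<rightarrow>\<^sub>E {0..w - 1}" and ?s = "\<lambda>i. \<Sum>l = 1..k. i l"
  let ?c = "fact k * real (w choose k) * (real (n - w) ^ (w - 1) / fact (w - 1)) ^ k"
  have finX: "finite ?X" by (simp add: finite_PiE)
  have "(\<Sum>i\<in>?X. tuple_weight w k w (n - w) i) = (\<Sum>i\<in>{i \<in> ?X. ?s i \<le> w - k}. tuple_weight w k w (n - w) i)"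
    using finX tuple_weight_eq_0[of _ k w "n - w"] by (intro sum.mono_neutral_right) (auto simp: not_le)
  also have "\<dots> = (\<Sum>j\<in>{0..w - k}. \<Sum>i\<in>{i \<in> {i \<in> ?X. ?s i \<le> w - k}. ?s i = j}. tuple_weight w k w (n - w) i)"
    using finX by (intro sum.group[symmetric]) auto
  also have "\<dots> = (\<Sum>j\<in>{0..w - k}. \<Sum>i\<in>{i \<in> {1..k} \<rightarrow>\<^sub>E {0..j}. ?s i = j}. tuple_weight w k w (n - w) i)"
  proof (intro sum.cong refl)
    fix j assume j: "j \<in> {0..w - k}"
    have le: "i l \<le> ?s i" if "l \<in> {1..k}" for i :: "nat \<Rightarrow> nat" and l
      using that by (intro member_le_sum) auto
    have "j \<le> w - 1" using j assms(1) by auto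
    then show "{i \<in> {i \<in> ?X. ?s i \<le> w - k}. ?s i = j} = {i \<in> {1..k} \<rightarrow>\<^sub>E {0..j}. ?s i = j}"
      using j le by (auto simp: PiE_iff) (meson atLeastAtMost_iff order_trans)
  qed
  also have "\<dots> = (\<Sum>j\<in>{0..w - k}. \<Sum>i\<in>{i \<in> {1..k} \<rightarrow>\<^sub>E {0..j}. ?s i = j}. ?c *
     (real ((w - k) choose j) * (\<Prod>l = 1..k * (w - 1) - j - 1. 1 - real l / real (n - w)) * (real w / real (n - w)) ^ j
       * (fact j / (\<Prod>s = 1..k. fact (i s))
           * (\<Prod>l = 1..k. 1 / (real (i l) + 1) * (\<Prod>s = 1..i l. 1 - real s / real w)))))"
  proof (intro sum.cong refl tuple_weight_eq assms)
    fix j i assume *: "j \<in> {0..w - k}" "i \<in> {i \<in> {1..k} \<rightarrow>\<^sub>E {0..j}. ?s i = j}"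
    then show "j \<le> w - k" "?s i = j" "0 < n - w" using assms by auto
    have "j \<le> w - 1" using * assms(1) by auto
    then have "{0..j} \<subseteq> {0..w - 1}" by auto
    then show "i \<in> ?X" using * PiE_mono[of "{1..k}" "\<lambda>_. {0..j}" "\<lambda>_. {0..w - 1}"] by blast
  qed
  also have "\<dots> = ?c * Gamma_tilde k w n"
    using assms(3) unfolding Gamma_tilde_def sum_distrib_left by (simp add: of_nat_diff mult.assoc)
  finally show ?thesis by (simp add: mult_ac)
qed

lemma nbr_families_touching:
  assumes "W \<in> col_sets n w"
  shows "{J \<in> nbr_families n w {W}. card J = k} = touching_families w W ({1..n} - W) k"
proof -
  have "W \<subseteq> {1..n}" using assms by (simp add: col_sets_def)
  then have "W \<union> ({1..n} - W) = {1..n}" by blast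
  moreover have "finite J" if "J \<subseteq> col_sets n w" for J
    using that finite_subset finite_col_sets by blast
  ultimately show ?thesis
    unfolding nbr_families_def touching_families_def meets_def
    by (auto simp: col_sets_def Int_commute)
qed

lemma card_nbr_families:
  assumes "W \<in> col_sets n w" "1 \<le> w" "w < n"
  shows "card {J \<in> nbr_families n w {W}. card J = k}
    = (if k = 0 then 1 else if k \<le> min (n div w) w
       then real (w choose k) * Gamma_tilde k w n * (real (n - w) ^ (w - 1) / fact (w - 1)) ^ k else 0)"
proof -
  have W: "finite W" "card W = w" "W \<subseteq> {1..n}"
    using assms(1) finite_subset by (auto simp: col_sets_def)
  then have Y: "card ({1..n} - W) = n - w"
    by (simp add: card_Diff_subset)
  have *: "fact k * real (card {J \<in> nbr_families n w {W}. card J = k})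
      = (\<Sum>i\<in>{1..k} \<rightarrow>\<^sub>E {0..w - 1}. tuple_weight w k w (n - w) i)"
    using card_touching_families[of W "{1..n} - W" w k] W Y assms(2)
    by (simp add: nbr_families_touching[OF assms(1)])
  consider "k = 0" | "1 \<le> k" "k \<le> min (n div w) w" | "w < k \<or> n div w < k" by linarith
  then show ?thesis
  proof cases
    case 1
    then show ?thesis by (simp add: nbr_families_touching[OF assms(1)] touching_families_0)
  next
    case 2
    then show ?thesis using * sum_tuple_weight[of k w n] assms by simp
  next
    case 3
    \<comment> \<open>Either more than \<open>w\<close> disjoint sets would all have to meet
      \<open>W\<close>, or \<open>k\<close> disjoint \<open>w\<close>-sets would have to fit into
      fewer than \<open>k * w\<close> columns.\<close>
    then have "w < k \<or> (n - w) + w < k * w"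
      using assms by (auto simp: div_less_iff_less_mult)
    then have "(\<Sum>i\<in>{1..k} \<rightarrow>\<^sub>E {0..w - 1}. tuple_weight w k w (n - w) i) = 0"
      using tuple_weight_eq_0[of _ k w "n - w"] by (intro sum.neutral) blast
    then show ?thesis using * 3 by auto
  qed
qed

section \<open>The polynomial as generating function of neighbouring families\<close>

lemma poly_phi:
  "poly (phi w n) x = 1 + (\<Sum>k = 1..min (n div w) w. real (w choose k) * Gamma_tilde k w n * x ^ k)"
  by (simp add: phi_def poly_sum poly_monom)

lemma poly_pderiv_phi:
  "x * poly (pderiv (phi w n)) x
    = (\<Sum>k = 1..min (n div w) w. real k * (real (w choose k) * Gamma_tilde k w n * x ^ k))"
proof -
  have "pderiv (phi w n) = (\<Sum>k = 1..min (n div w) w. pderiv (monom (real (w choose k) * Gamma_tilde k w n) k))"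
    by (simp add: phi_def pderiv_add higher_pderiv_sum[of 1, simplified])
  then show ?thesis
    by (auto simp: poly_sum pderiv_monom poly_monom sum_distrib_left power_eq_if intro!: sum.cong)
qed

text \<open>Evaluating at \<open>\<tau> / C\<close> cancels the factor \<open>C ^ k\<close> in the
  number of families of size \<open>k\<close>.\<close>

lemma sum_nbr_families:
  fixes \<tau> :: real
  assumes "W \<in> col_sets n w" "1 \<le> w" "w < n"
  defines "C \<equiv> real (n - w) ^ (w - 1) / fact (w - 1)"
  shows "(\<Sum>J\<in>nbr_families n w {W}. (\<tau> / C) ^ card J) = poly (phi w n) \<tau>"
proof -
  let ?S = "nbr_families n w {W}" and ?K = "min (n div w) w"
  let ?n = "\<lambda>k. card {J \<in> ?S. card J = k}"
  have C: "C \<noteq> 0" using assms(3) by (simp add: C_def)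
  \<comment> \<open>A larger family would contradict the zero count for its size; this makes the
    grouping by size exhaustive.\<close>
  have "card J \<le> ?K" if "J \<in> ?S" for J
  proof (rule ccontr)
    assume "\<not> card J \<le> ?K"
    then have "?n (card J) = 0" using card_nbr_families[OF assms(1-3), of "card J"] by auto
    moreover have "J \<in> {J' \<in> ?S. card J' = card J}" using that by simp
    moreover have "finite {J' \<in> ?S. card J' = card J}" by simp
    ultimately show False by (metis card_0_eq empty_iff)
  qed
  then have "(\<Sum>J\<in>?S. (\<tau> / C) ^ card J) = (\<Sum>k\<in>{0..?K}. \<Sum>J\<in>{J \<in> ?S. card J = k}. (\<tau> / C) ^ card J)"
    by (intro sum.group[symmetric]) auto
  also have "\<dots> = (\<Sum>k\<in>{0..?K}. real (?n k) * (\<tau> / C) ^ k)"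
    by (intro sum.cong refl) simp
  also have "\<dots> = 1 + (\<Sum>k = 1..?K. real (?n k) * (\<tau> / C) ^ k)"
    using card_nbr_families[OF assms(1-3), of 0] by (simp add: sum.atLeast_Suc_atMost)
  also have "(\<Sum>k = 1..?K. real (?n k) * (\<tau> / C) ^ k)
      = (\<Sum>k = 1..?K. real (w choose k) * Gamma_tilde k w n * \<tau> ^ k)"
  proof (intro sum.cong refl)
    fix k assume "k \<in> {1..?K}"
    then have "real (?n k) = real (w choose k) * Gamma_tilde k w n * C ^ k"
      unfolding C_def by (simp only: card_nbr_families[OF assms(1-3)]) simp
    then show "real (?n k) * (\<tau> / C) ^ k = real (w choose k) * Gamma_tilde k w n * \<tau> ^ k"
      using C by (simp add: power_divide)
  qed
  finally show ?thesis by (simp add: poly_phi)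
qed

section \<open>The algorithm as a random process\<close>

text \<open>A function of finitely many coordinates is a finite combination of indicators of the
  cylinders \<open>A x\<close>, all of the same probability.\<close>

lemma nn_integral_PiM_uniform_restrict:
  fixes F :: "('i \<Rightarrow> 'a) \<Rightarrow> real"
  assumes "finite T" "T \<noteq> {}" "finite J" "J \<subseteq> I" "\<And>x. 0 \<le> F x"
  defines "P \<equiv> Pi\<^sub>M I (\<lambda>_. uniform_count_measure T)"
  shows "(\<lambda>\<omega>. ennreal (F (restrict \<omega> J))) \<in> borel_measurable P"
    and "(\<integral>\<^sup>+ \<omega>. ennreal (F (restrict \<omega> J)) \<partial>P) = ennreal (mean (J \<rightarrow>\<^sub>E T) F)"
proof -
  let ?X = "J \<rightarrow>\<^sub>E T" and ?u = "\<lambda>_. uniform_count_measure T"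
  have fin: "finite ?X" using assms by (simp add: finite_PiE)
  have ps: "prob_space (?u i)" for i :: 'i
    using assms by (intro prob_space_uniform_count_measure)
  have sp: "space P = I \<rightarrow>\<^sub>E T"
    by (simp add: P_def space_PiM space_uniform_count_measure)
  define A where "A x = {\<omega> \<in> space P. restrict \<omega> J = x}" for x
  have A: "A x = prod_emb I ?u J (\<Pi>\<^sub>E i\<in>J. {x i})" if "x \<in> ?X" for x
    using that assms(4) unfolding A_def sp prod_emb_def
    by (auto simp: space_uniform_count_measure PiE_iff extensional_def fun_eq_iff restrict_def)
  have sets: "A x \<in> sets P" if "x \<in> ?X" for x
    unfolding A[OF that] P_def using assms that
    by (intro sets_PiM_I) (auto simp: sets_uniform_count_measure)
  have em: "emeasure P (A x) = ennreal (1 / real (card ?X))" if "x \<in> ?X" for x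
  proof -
    have "emeasure P (A x) = (\<Prod>i\<in>J. emeasure (?u i) {x i})"
      unfolding A[OF that] P_def using that assms
      by (intro emeasure_PiM_emb ps) (auto simp: sets_uniform_count_measure)
    also have "\<dots> = (\<Prod>i\<in>J. ennreal (1 / real (card T)))"
      using that assms by (intro prod.cong refl) (auto simp: emeasure_uniform_count_measure PiE_iff)
    also have "\<dots> = ennreal (1 / real (card ?X))"
      using assms(3) by (simp add: card_PiE ennreal_power power_divide)
    finally show ?thesis .
  qed
  have eq: "ennreal (F (restrict \<omega> J)) = (\<Sum>x\<in>?X. ennreal (F x) * indicator (A x) \<omega>)"
    if "\<omega> \<in> space P" for \<omega>
  proof -
    have "restrict \<omega> J \<in> ?X" using that assms(4) unfolding sp by auto
    moreover have "ennreal (F x) * indicator (A x) \<omega>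
        = (if x = restrict \<omega> J then ennreal (F x) else 0)" for x
      using that by (auto simp: A_def indicator_def)
    ultimately show ?thesis using fin by (simp only: sum.delta if_True)
  qed
  have meas: "(\<lambda>\<omega>. \<Sum>x\<in>?X. ennreal (F x) * indicator (A x) \<omega>) \<in> borel_measurable P"
    using sets by measurable
  then show "(\<lambda>\<omega>. ennreal (F (restrict \<omega> J))) \<in> borel_measurable P"
    using eq by (subst measurable_cong) auto
  have "(\<integral>\<^sup>+ \<omega>. ennreal (F (restrict \<omega> J)) \<partial>P)
      = (\<integral>\<^sup>+ \<omega>. (\<Sum>x\<in>?X. ennreal (F x) * indicator (A x) \<omega>) \<partial>P)"
    by (intro nn_integral_cong eq)
  also have "\<dots> = (\<Sum>x\<in>?X. ennreal (F x) * emeasure P (A x))"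
    using sets by (subst nn_integral_sum) (auto simp: nn_integral_cmult_indicator)
  also have "\<dots> = (\<Sum>x\<in>?X. ennreal (F x / real (card ?X)))"
    by (intro sum.cong refl) (simp add: em assms(5) ennreal_mult[symmetric])
  also have "\<dots> = ennreal (\<Sum>x\<in>?X. F x / real (card ?X))"
    using assms(5) by (intro sum_ennreal) simp
  also have "(\<Sum>x\<in>?X. F x / real (card ?X)) = mean ?X F"
    by (simp add: mean_def sum_divide_distrib)
  finally show "(\<integral>\<^sup>+ \<omega>. ennreal (F (restrict \<omega> J)) \<partial>P) = ennreal (mean ?X F)" .
qed

section \<open>Histories of the algorithm and their conditional means\<close>

abbreviation times_upto :: "nat \<Rightarrow> nat \<Rightarrow> nat \<Rightarrow> (nat \<times> nat \<times> nat) set" where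
  "times_upto N n k \<equiv> {..k} \<times> {1..N} \<times> {1..n}"

lemma mt_history_cong:
  "(\<And>t i j. t \<le> k \<Longrightarrow> \<omega> (t, i, j) = \<omega>' (t, i, j))
    \<Longrightarrow> mt_history N n w sel \<omega> k = mt_history N n w sel \<omega>' k"
  by (induction k) (simp_all add: Let_def cong: if_cong)

lemma mt_history_restrict:
  assumes "\<omega> \<in> UNIV \<times> {1..N} \<times> {1..n} \<rightarrow>\<^sub>E T"
  shows "mt_history N n w sel (restrict \<omega> (times_upto N n k)) k = mt_history N n w sel \<omega> k"
  using assms by (intro mt_history_cong) (auto simp: restrict_def PiE_iff extensional_def)

text \<open>A whole fresh matrix \<open>B\<close> is supplied although only the columns in
  \<open>sel h\<close> are copied, so each step draws from the same space
  \<open>mats\<close>.\<close>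

definition mt_step :: "nat \<Rightarrow> nat \<Rightarrow> nat \<Rightarrow> (mat list \<Rightarrow> nat set) \<Rightarrow> mat list \<Rightarrow> mat \<Rightarrow> mat" where
  "mt_step N n w sel h B = (if bad_sets N n w (last h) = {} then last h
     else override_on (last h) B (UNIV \<times> sel h))"

lemma mt_history_Suc:
  "mt_history N n w sel \<omega> (Suc k) = (let h = mt_history N n w sel \<omega> k
     in h @ [mt_step N n w sel h (\<lambda>(i, j). \<omega> (Suc k, i, j))])"
proof -
  have "(\<lambda>(i, j). if j \<in> S then \<omega> (Suc k, i, j) else A (i, j))
      = override_on A (\<lambda>(i, j). \<omega> (Suc k, i, j)) (UNIV \<times> S)" for A S
    by (auto simp: override_on_def)
  then show ?thesis by (simp only: mt_history.simps(2) Let_def mt_step_def)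
qed

text \<open>Fubini for finite sums: the values of time \<open>Suc k\<close> form one matrix,
  independent of all earlier values.\<close>

lemma mean_times_upto_Suc:
  assumes "1 \<le> m"
  shows "mean (times_upto N n (Suc k) \<rightarrow>\<^sub>E {1..m}) F
    = mean (times_upto N n k \<rightarrow>\<^sub>E {1..m}) (\<lambda>\<omega>. mean (mats N n m)
        (\<lambda>B. F (\<lambda>(t, z). if t = Suc k then B z else \<omega> (t, z))))"
proof -
  let ?X = "times_upto N n k \<rightarrow>\<^sub>E {1..m}" and ?Y = "times_upto N n (Suc k) \<rightarrow>\<^sub>E {1..m}"
  let ?f = "\<lambda>(\<omega>, B). \<lambda>(t, z). if t = Suc k then B z else \<omega> (t, z)"
  have bij: "bij_betw ?f (?X \<times> mats N n m) ?Y"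
  proof (rule bij_betw_byWitness[where f' = "\<lambda>\<omega>. (restrict \<omega> (times_upto N n k), \<lambda>z. \<omega> (Suc k, z))"])
    show "\<forall>z\<in>?X \<times> mats N n m. (restrict (?f z) (times_upto N n k), \<lambda>y. ?f z (Suc k, y)) = z"
    proof (intro ballI, clarify, intro conjI ext)
      fix \<omega> B and x :: "nat \<times> nat \<times> nat" assume "\<omega> \<in> ?X"
      then show "restrict (\<lambda>(t, z). if t = Suc k then B z else \<omega> (t, z)) (times_upto N n k) x = \<omega> x"
        by (cases x) (auto simp: restrict_def PiE_iff extensional_def)
    qed simp
    show "\<forall>\<omega>\<in>?Y. ?f (restrict \<omega> (times_upto N n k), \<lambda>z. \<omega> (Suc k, z)) = \<omega>"
    proof (intro ballI ext)
      fix \<omega> x assume "\<omega> \<in> ?Y"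
      then have "\<omega> x = undefined" if "x \<notin> times_upto N n (Suc k)" for x
        using that by (rule PiE_arb)
      then show "?f (restrict \<omega> (times_upto N n k), \<lambda>z. \<omega> (Suc k, z)) x = \<omega> x"
        by (cases x) (auto simp: restrict_def)
    qed
    show "?f ` (?X \<times> mats N n m) \<subseteq> ?Y"
    proof (rule image_subsetI, clarify, rule PiE_I)
      fix \<omega> B and x :: "nat \<times> nat \<times> nat" assume *: "\<omega> \<in> ?X" "B \<in> mats N n m"
      obtain t z where x: "x = (t, z)" by (cases x)
      show "(\<lambda>(t, z). if t = Suc k then B z else \<omega> (t, z)) x \<in> {1..m}" if "x \<in> times_upto N n (Suc k)"
      proof (cases "t = Suc k")
        case True
        then show ?thesis using PiE_mem[OF *(2)[unfolded mats_def], of z] that by (simp add: x)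
      next
        case False
        then show ?thesis using PiE_mem[OF *(1), of x] that by (simp add: x)
      qed
      show "(\<lambda>(t, z). if t = Suc k then B z else \<omega> (t, z)) x = undefined" if "x \<notin> times_upto N n (Suc k)"
      proof (cases "t = Suc k")
        case True
        then show ?thesis using PiE_arb[OF *(2)[unfolded mats_def], of z] that by (simp add: x)
      next
        case False
        then show ?thesis using PiE_arb[OF *(1), of x] that by (simp add: x)
      qed
    qed
    show "(\<lambda>\<omega>. (restrict \<omega> (times_upto N n k), \<lambda>z. \<omega> (Suc k, z))) ` ?Y \<subseteq> ?X \<times> mats N n m"
    proof (rule image_subsetI)
      fix \<omega> assume *: "\<omega> \<in> ?Y"
      have "restrict \<omega> (times_upto N n k) \<in> ?X"
        using PiE_mem[OF *] by (intro restrict_PiE_iff[THEN iffD2]) auto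
      moreover have "(\<lambda>z. \<omega> (Suc k, z)) \<in> mats N n m"
        unfolding mats_def using PiE_mem[OF *] PiE_arb[OF *] by (intro PiE_I) auto
      ultimately show "(restrict \<omega> (times_upto N n k), \<lambda>z. \<omega> (Suc k, z)) \<in> ?X \<times> mats N n m"
        by simp
    qed
  qed
  have "(\<Sum>\<omega>\<in>?Y. F \<omega>) = (\<Sum>z\<in>?X \<times> mats N n m. F (?f z))"
    by (rule sum.reindex_bij_betw[OF bij, symmetric])
  also have "\<dots> = (\<Sum>\<omega>\<in>?X. \<Sum>B\<in>mats N n m. F (?f (\<omega>, B)))"
    unfolding sum.cartesian_product by (rule sum.cong) auto
  moreover have "card ?Y = card ?X * card (mats N n m)"
    using bij_betw_same_card[OF bij] by (simp add: card_cartesian_product)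
  ultimately show ?thesis
    by (simp add: mean_def sum_divide_distrib[symmetric] mult.commute)
qed

text \<open>The history up to \<open>k\<close> ignores the values of time \<open>Suc k\<close>, so
  the inner mean is the conditional expectation given that history.\<close>

lemma mean_history_Suc:
  assumes "1 \<le> m"
  shows "mean (times_upto N n (Suc k) \<rightarrow>\<^sub>E {1..m}) (\<lambda>\<omega>. f (mt_history N n w sel \<omega> (Suc k)))
    = mean (times_upto N n k \<rightarrow>\<^sub>E {1..m}) (\<lambda>\<omega>. let h = mt_history N n w sel \<omega> k in
        mean (mats N n m) (\<lambda>B. f (h @ [mt_step N n w sel h B])))"
proof -
  have h: "mt_history N n w sel (\<lambda>(t, z). if t = Suc k then B z else \<omega> (t, z)) k
      = mt_history N n w sel \<omega> k" for B \<omega>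
    by (rule mt_history_cong) simp
  show ?thesis
    unfolding mean_times_upto_Suc[OF assms] mt_history_Suc h Let_def by simp
qed

lemma mean_history_0:
  assumes "1 \<le> m"
  shows "mean (times_upto N n 0 \<rightarrow>\<^sub>E {1..m}) (\<lambda>\<omega>. f (mt_history N n w sel \<omega> 0))
    = mean (mats N n m) (\<lambda>A. f [A])"
proof -
  let ?X = "times_upto N n 0 \<rightarrow>\<^sub>E {1..m}"
  have bij: "bij_betw (\<lambda>\<omega> z. \<omega> (0, z)) ?X (mats N n m)"
  proof (rule bij_betw_byWitness[where f' = "\<lambda>A (t, z). if t = 0 then A z else undefined"])
    show "\<forall>\<omega>\<in>?X. (\<lambda>(t, z). if t = 0 then \<omega> (0, z) else undefined) = \<omega>"
    proof (intro ballI ext)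
      fix \<omega> x assume *: "\<omega> \<in> ?X"
      show "(\<lambda>(t, z). if t = 0 then \<omega> (0, z) else undefined) x = \<omega> x"
        using PiE_arb[OF *, of x] by (cases x) simp
    qed
    show "(\<lambda>\<omega> z. \<omega> (0, z)) ` ?X \<subseteq> mats N n m"
    proof (rule image_subsetI)
      fix \<omega> assume *: "\<omega> \<in> ?X"
      show "(\<lambda>z. \<omega> (0, z)) \<in> mats N n m"
        unfolding mats_def using PiE_mem[OF *] PiE_arb[OF *] by (intro PiE_I) auto
    qed
    show "(\<lambda>A (t, z). if t = 0 then A z else undefined) ` mats N n m \<subseteq> ?X"
    proof (rule image_subsetI)
      fix A assume *: "A \<in> mats N n m"
      show "(\<lambda>(t, z). if t = 0 then A z else undefined) \<in> ?X"
      proof (rule PiE_I)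
        fix x :: "nat \<times> nat \<times> nat"
        obtain t z where x: "x = (t, z)" by (cases x)
        show "(\<lambda>(t, z). if t = 0 then A z else undefined) x \<in> {1..m}" if "x \<in> times_upto N n 0"
          using PiE_mem[OF *[unfolded mats_def], of z] that by (simp add: x)
        show "(\<lambda>(t, z). if t = 0 then A z else undefined) x = undefined" if "x \<notin> times_upto N n 0"
          using PiE_arb[OF *[unfolded mats_def], of z] that by (cases "t = 0") (simp_all add: x)
      qed
    qed
  qed simp
  have "(\<Sum>A\<in>mats N n m. f [A]) = (\<Sum>\<omega>\<in>?X. f [\<lambda>z. \<omega> (0, z)])"
    by (rule sum.reindex_bij_betw[OF bij, symmetric])
  then show ?thesis
    using bij_betw_same_card[OF bij] by (simp add: mean_def case_prod_unfold)
qed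

definition alive :: "nat \<Rightarrow> nat \<Rightarrow> nat \<Rightarrow> mat list \<Rightarrow> real" where
  "alive N n w h = of_bool (bad_sets N n w (last h) \<noteq> {})"

text \<open>The supermartingale: each step that finds a bad event consumes one unit of the potential.\<close>

lemma mean_steps_potential:
  assumes "1 \<le> m" "1 \<le> w" "selection_rule N n w sel" "k \<le> K"
  shows "(\<Sum>t<k. mean (times_upto N n t \<rightarrow>\<^sub>E {1..m}) (\<lambda>\<omega>. alive N n w (mt_history N n w sel \<omega> t)))
    + mean (times_upto N n k \<rightarrow>\<^sub>E {1..m}) (\<lambda>\<omega>. alive N n w (mt_history N n w sel \<omega> k)
        * potential N n m w (K - k) (last (mt_history N n w sel \<omega> k)))
    \<le> mean (mats N n m) (potential N n m w K)"
  using assms(4)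
proof (induction k)
  case 0
  have "mean (times_upto N n 0 \<rightarrow>\<^sub>E {1..m}) (\<lambda>\<omega>. alive N n w (mt_history N n w sel \<omega> 0)
        * potential N n m w K (last (mt_history N n w sel \<omega> 0)))
      = mean (mats N n m) (\<lambda>A. alive N n w [A] * potential N n m w K (last [A]))"
    by (rule mean_history_0[OF assms(1)])
  also have "\<dots> \<le> mean (mats N n m) (potential N n m w K)"
    by (intro mean_mono) (auto simp: alive_def potential_nonneg)
  finally show ?case by (simp only: lessThan_0 sum.empty add_0 diff_zero)
next
  case (Suc k)
  let ?X = "times_upto N n k \<rightarrow>\<^sub>E {1..m}" and ?h = "\<lambda>\<omega>. mt_history N n w sel \<omega> k"
  let ?V = "potential N n m w"
  \<comment> \<open>Each step gives up one layer, as \<open>potential_step\<close> requires;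
    starting with \<open>K\<close> layers suffices for \<open>K\<close> steps.\<close>
  have Kk: "K - k = Suc (K - Suc k)" using Suc.prems by simp
  have ne: "h \<noteq> [] \<Longrightarrow> alive N n w h + mean (mats N n m) (\<lambda>B. alive N n w (h @ [mt_step N n w sel h B])
      * ?V (K - Suc k) (mt_step N n w sel h B)) \<le> alive N n w h * ?V (K - k) (last h)" for h
  proof (cases "bad_sets N n w (last h) = {}")
    case True
    \<comment> \<open>A stopped run repeats its last matrix, so it stays dead and both sides are
      0.\<close>
    then show ?thesis using assms(1) by (simp add: alive_def mt_step_def)
  next
    case False
    assume "h \<noteq> []"
    with False have "sel h \<in> bad_sets N n w (last h)"
      using assms(3) by (simp add: selection_rule_def)
    from potential_step[OF assms(1,2) this, of "K - Suc k"]
    have "1 + mean (mats N n m) (\<lambda>B. ?V (K - Suc k) (mt_step N n w sel h B)) \<le> ?V (K - k) (last h)"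
      using False by (simp add: mt_step_def Kk)
    moreover have "mean (mats N n m) (\<lambda>B. alive N n w (h @ [mt_step N n w sel h B])
        * ?V (K - Suc k) (mt_step N n w sel h B))
      \<le> mean (mats N n m) (\<lambda>B. ?V (K - Suc k) (mt_step N n w sel h B))"
      by (intro mean_mono) (auto simp: alive_def potential_nonneg)
    ultimately show ?thesis using False by (simp add: alive_def)
  qed
  have nonempty: "?h \<omega> \<noteq> []" for \<omega> by (cases k) (simp_all add: Let_def)
  have "mean ?X (\<lambda>\<omega>. alive N n w (?h \<omega>))
      + mean (times_upto N n (Suc k) \<rightarrow>\<^sub>E {1..m}) (\<lambda>\<omega>. alive N n w (mt_history N n w sel \<omega> (Suc k))
        * ?V (K - Suc k) (last (mt_history N n w sel \<omega> (Suc k))))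
    = mean ?X (\<lambda>\<omega>. alive N n w (?h \<omega>) + mean (mats N n m) (\<lambda>B. alive N n w (?h \<omega> @ [mt_step N n w sel (?h \<omega>) B])
      * ?V (K - Suc k) (mt_step N n w sel (?h \<omega>) B)))"
    by (simp only: mean_history_Suc[OF assms(1), where f = "\<lambda>h. alive N n w h * ?V (K - Suc k) (last h)"]
        Let_def mean_add last_snoc)
  also have "\<dots> \<le> mean ?X (\<lambda>\<omega>. alive N n w (?h \<omega>) * ?V (K - k) (last (?h \<omega>)))"
    by (intro mean_mono ne nonempty)
  finally show ?case using Suc by simp
qed

text \<open>For the first \<open>K\<close> steps the potential with \<open>K\<close> layers is used
  and its nonnegative remainder dropped. Since \<open>M\<close> is uniform in the number of layers,
  the bound passes to the infinite series.\<close>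

lemma expected_alive_steps:
  assumes "1 \<le> m" "1 \<le> w" "selection_rule N n w sel"
    "\<And>h. mean (mats N n m) (potential N n m w h) \<le> M"
  shows "(\<lambda>\<omega>. ennreal (alive N n w (mt_history N n w sel \<omega> k))) \<in> borel_measurable (mt_space N n m)"
    and "(\<Sum>k. \<integral>\<^sup>+ \<omega>. ennreal (alive N n w (mt_history N n w sel \<omega> k)) \<partial>mt_space N n m) \<le> ennreal M"
proof -
  let ?P = "mt_space N n m"
  have sp: "space ?P = UNIV \<times> {1..N} \<times> {1..n} \<rightarrow>\<^sub>E {1..m}"
    by (simp add: mt_space_def space_PiM space_uniform_count_measure)
  have T: "finite {1..m}" "{1..m} \<noteq> {}" using assms(1) by auto
  have J: "finite (times_upto N n k)" "times_upto N n k \<subseteq> UNIV \<times> {1..N} \<times> {1..n}" for k by auto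
  have nn: "0 \<le> alive N n w (mt_history N n w sel x k)" for x k by (simp add: alive_def)
  note int = nn_integral_PiM_uniform_restrict[OF T J(1) J(2),
      where F = "\<lambda>x. alive N n w (mt_history N n w sel x k)" for k, OF nn, folded mt_space_def]
  have eq: "ennreal (alive N n w (mt_history N n w sel (restrict \<omega> (times_upto N n k)) k))
      = ennreal (alive N n w (mt_history N n w sel \<omega> k))" if "\<omega> \<in> space ?P" for \<omega> k
    using mt_history_restrict[of \<omega> N n "{1..m}"] that by (simp add: sp)
  show "(\<lambda>\<omega>. ennreal (alive N n w (mt_history N n w sel \<omega> k))) \<in> borel_measurable ?P"
    using int(1)[of k k] eq by (subst measurable_cong[symmetric]) auto
  have "(\<integral>\<^sup>+ \<omega>. ennreal (alive N n w (mt_history N n w sel \<omega> k)) \<partial>?P)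
      = ennreal (mean (times_upto N n k \<rightarrow>\<^sub>E {1..m}) (\<lambda>\<omega>. alive N n w (mt_history N n w sel \<omega> k)))" for k
    using int(2)[of k k] eq by (simp cong: nn_integral_cong)
  then have "(\<Sum>k<K. \<integral>\<^sup>+ \<omega>. ennreal (alive N n w (mt_history N n w sel \<omega> k)) \<partial>?P)
      = ennreal (\<Sum>k<K. mean (times_upto N n k \<rightarrow>\<^sub>E {1..m}) (\<lambda>\<omega>. alive N n w (mt_history N n w sel \<omega> k)))" for K
    by (simp add: sum_ennreal mean_nonneg nn)
  moreover have "(\<Sum>k<K. mean (times_upto N n k \<rightarrow>\<^sub>E {1..m}) (\<lambda>\<omega>. alive N n w (mt_history N n w sel \<omega> k))) \<le> M" for K
  proof -
    have "0 \<le> mean (times_upto N n K \<rightarrow>\<^sub>E {1..m}) (\<lambda>\<omega>. alive N n w (mt_history N n w sel \<omega> K)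
        * potential N n m w (K - K) (last (mt_history N n w sel \<omega> K)))"
      by (intro mean_nonneg mult_nonneg_nonneg nn potential_nonneg)
    then show ?thesis
      using mean_steps_potential[OF assms(1-3) order.refl[of K]] assms(4)[of K] by linarith
  qed
  ultimately show "(\<Sum>k. \<integral>\<^sup>+ \<omega>. ennreal (alive N n w (mt_history N n w sel \<omega> k)) \<partial>?P) \<le> ennreal M"
    by (intro suminf_le_const) (auto intro: ennreal_leI)
qed

section \<open>The main bound\<close>

lemma mt_matrix_mats:
  assumes "\<omega> \<in> UNIV \<times> {1..N} \<times> {1..n} \<rightarrow>\<^sub>E {1..m}"
  shows "mt_matrix N n w sel \<omega> k \<in> mats N n m"
proof (induction k)
  have slice: "(\<lambda>(i, j). \<omega> (t, i, j)) \<in> mats N n m" for t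
    unfolding mats_def
  proof (rule PiE_I)
    fix z :: "nat \<times> nat"
    show "(\<lambda>(i, j). \<omega> (t, i, j)) z \<in> {1..m}" if "z \<in> {1..N} \<times> {1..n}"
      using PiE_mem[OF assms, of "(t, z)"] that by (cases z) simp
    show "(\<lambda>(i, j). \<omega> (t, i, j)) z = undefined" if "z \<notin> {1..N} \<times> {1..n}"
      using PiE_arb[OF assms, of "(t, z)"] that by (cases z) simp
  qed
  {
    case 0
    show ?case using slice[of 0] by (simp add: mt_matrix_def case_prod_unfold)
  next
    case (Suc k)
    then show ?case
      using override_on_PiE[OF _ slice[of "Suc k", unfolded mats_def]]
      by (simp add: mt_matrix_def mt_history_Suc mt_step_def Let_def mats_def del: mt_history.simps)
  }
qed

lemma is_PHF_iff_bad_sets: "is_PHF N n m w A \<longleftrightarrow> A \<in> mats N n m \<and> bad_sets N n w A = {}"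
proof -
  have "bad_event N W A \<longleftrightarrow> \<not> (\<exists>i\<in>{1..N}. inj_on (\<lambda>j. A (i, j)) W)" for W
    unfolding bad_event_def inj_on_def by blast
  then show ?thesis unfolding is_PHF_def bad_sets_def by blast
qed

text \<open>\<open>S\<close> counts the resamplings. Every check except the first follows a matrix
  with a bad event, so there are at most \<open>1 + S\<close> checks.\<close>

lemma mt_time_le:
  fixes s c N n w :: nat and sel \<omega>
  defines "S \<equiv> \<Sum>k. ennreal (alive N n w (mt_history N n w sel \<omega> k))"
  shows "mt_time s c N n w sel \<omega> \<le> of_nat (N * n * s)
    + (of_nat ((n choose w) * N * (w choose 2) * c) * (1 + S) + of_nat (N * w * s) * S)"
proof -
  let ?a = "\<lambda>k. ennreal (alive N n w (mt_history N n w sel \<omega> k))"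
  let ?D = "of_nat ((n choose w) * N * (w choose 2) * c) :: ennreal" and ?E = "of_nat (N * w * s) :: ennreal"
  \<comment> \<open>The indicator of a bad event one matrix earlier; it dominates the condition that
    all earlier matrices were bad, and 1 stands for the first check.\<close>
  define u where "u k = (case k of 0 \<Rightarrow> 1 | Suc j \<Rightarrow> ?a j)" for k
  have u: "u 0 = 1" "u (Suc k) = ?a k" for k
    by (simp_all add: u_def)
  have a: "?a k = (if bad_sets N n w (mt_matrix N n w sel \<omega> k) \<noteq> {} then 1 else 0)" for k
    by (simp add: alive_def mt_matrix_def)
  have "(if \<forall>i<k. bad_sets N n w (mt_matrix N n w sel \<omega> i) \<noteq> {}
             then of_nat ((n choose w) * N * (w choose 2) * c
                    + (if bad_sets N n w (mt_matrix N n w sel \<omega> k) \<noteq> {} then N * w * s else 0))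
             else 0) \<le> ?D * u k + ?E * ?a k" for k
    unfolding a u_def by (cases k) auto
  then have "mt_time s c N n w sel \<omega> \<le> of_nat (N * n * s) + (\<Sum>k. ?D * u k + ?E * ?a k)"
    unfolding mt_time_def by (intro add_left_mono suminf_le summableI)
  also have "(\<Sum>k. ?D * u k + ?E * ?a k) = ?D * (\<Sum>k. u k) + ?E * S"
    unfolding S_def by (subst suminf_add[symmetric]) (auto intro: summableI)
  also have "(\<Sum>k. u k) = 1 + S"
    using suminf_offset[of u 1, OF summableI] by (simp add: u S_def add.commute)
  finally show ?thesis .
qed

lemma mt_analysis:
  assumes "1 \<le> m" "1 \<le> w" "selection_rule N n w sel"
    "\<And>h. mean (mats N n m) (potential N n m w h) \<le> real M"
  shows "AE \<omega> in mt_space N n m. \<exists>A. mt_outputs N n w sel \<omega> A \<and> is_PHF N n m w A"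
    and "(\<integral>\<^sup>+ \<omega>. mt_time s c N n w sel \<omega> \<partial>mt_space N n m)
      \<le> of_nat (N * n * s + ((n choose w) * N * (w choose 2) * c * (1 + M) + N * w * s * M))"
proof -
  let ?P = "mt_space N n m"
  interpret P: prob_space ?P
    unfolding mt_space_def using assms(1)
    by (intro prob_space_PiM prob_space_uniform_count_measure) auto
  define a where "a k \<omega> = ennreal (alive N n w (mt_history N n w sel \<omega> k))" for k \<omega>
  have meas [measurable]: "a k \<in> borel_measurable ?P" for k
    unfolding a_def by (rule expected_alive_steps(1)[OF assms])
  have "(\<integral>\<^sup>+ \<omega>. (\<Sum>k. a k \<omega>) \<partial>?P) = (\<Sum>k. \<integral>\<^sup>+ \<omega>. a k \<omega> \<partial>?P)"
    by (rule nn_integral_suminf) simp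
  also have "\<dots> \<le> of_nat M"
    using expected_alive_steps(2)[OF assms] by (simp add: a_def ennreal_of_nat_eq_real_of_nat)
  finally have le: "(\<integral>\<^sup>+ \<omega>. (\<Sum>k. a k \<omega>) \<partial>?P) \<le> of_nat M" .
  then have "(\<integral>\<^sup>+ \<omega>. (\<Sum>k. a k \<omega>) \<partial>?P) \<noteq> \<infinity>"
    by (auto simp: top_unique)
  then have "AE \<omega> in ?P. (\<Sum>k. a k \<omega>) \<noteq> \<infinity>"
    by (intro nn_integral_PInf_AE) measurable
  then show "AE \<omega> in ?P. \<exists>A. mt_outputs N n w sel \<omega> A \<and> is_PHF N n m w A"
  proof (rule AE_mp, intro AE_I2 impI)
    fix \<omega> assume \<omega>: "\<omega> \<in> space ?P" and fin: "(\<Sum>k. a k \<omega>) \<noteq> \<infinity>"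
    let ?b = "\<lambda>k. bad_sets N n w (mt_matrix N n w sel \<omega> k) = {}"
    have "\<exists>k. ?b k"
    proof (rule ccontr)
      assume "\<nexists>k. ?b k"
      then have one: "a k \<omega> = 1" for k by (simp add: a_def alive_def mt_matrix_def)
      \<comment> \<open>A nonterminating run contributes 1 at every index, so the sum would exceed
        every integer.\<close>
      have "of_nat K \<le> (\<Sum>k. a k \<omega>)" for K :: nat
        using sum_le_suminf[OF summableI, of "{..<K}" "\<lambda>k. a k \<omega>"] by (simp add: one)
      then show False
        using fin by (metis ennreal_of_nat_eq_real_of_nat ennreal_Ex_less_of_nat infinity_ennreal_def
            less_top not_less)
    qed
    \<comment> \<open>The least index is taken because \<open>mt_outputs\<close> demands the first
      matrix without a bad event.\<close>
    then have b: "?b (LEAST k. ?b k)" "\<forall>i<(LEAST k. ?b k). \<not> ?b i"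
      by (rule LeastI_ex, use not_less_Least in blast)
    have "mt_matrix N n w sel \<omega> k \<in> mats N n m" for k
      using \<omega> by (intro mt_matrix_mats) (simp add: mt_space_def space_PiM space_uniform_count_measure)
    then show "\<exists>A. mt_outputs N n w sel \<omega> A \<and> is_PHF N n m w A"
      using b unfolding mt_outputs_def is_PHF_iff_bad_sets by blast
  qed
  let ?D = "of_nat ((n choose w) * N * (w choose 2) * c) :: ennreal" and ?E = "of_nat (N * w * s) :: ennreal"
  have "(\<integral>\<^sup>+ \<omega>. mt_time s c N n w sel \<omega> \<partial>?P)
      \<le> (\<integral>\<^sup>+ \<omega>. of_nat (N * n * s) + (?D * (1 + (\<Sum>k. a k \<omega>)) + ?E * (\<Sum>k. a k \<omega>)) \<partial>?P)"
    unfolding a_def by (intro nn_integral_mono mt_time_le)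
  also have "\<dots> = of_nat (N * n * s) + (?D * (1 + (\<integral>\<^sup>+ \<omega>. (\<Sum>k. a k \<omega>) \<partial>?P)) + ?E * (\<integral>\<^sup>+ \<omega>. (\<Sum>k. a k \<omega>) \<partial>?P))"
    by (simp add: nn_integral_add nn_integral_cmult P.emeasure_space_1)
  also have "\<dots> \<le> of_nat (N * n * s) + (?D * (1 + of_nat M) + ?E * of_nat M)"
    by (intro add_mono mult_left_mono le order.refl) auto
  finally show "(\<integral>\<^sup>+ \<omega>. mt_time s c N n w sel \<omega> \<partial>?P)
      \<le> of_nat (N * n * s + ((n choose w) * N * (w choose 2) * c * (1 + M) + N * w * s * M))"
    by (simp only: of_nat_add of_nat_mult of_nat_1)
qed

section \<open>From the bound on \<open>N\<close> to the condition of the local lemma\<close>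

lemma mean_potential_le_binomial:
  fixes \<tau> :: real
  assumes w: "2 \<le> w" "w \<le> n" "w \<le> m"
    and \<tau>: "first_positive_zero (\<lambda>x. poly (phi w n) x - x * poly (pderiv (phi w n)) x) \<tau>"
    and N: "PHF_bound w n m \<tau> \<le> real N"
  shows "mean (mats N n m) (potential N n m w h) \<le> real (n choose w)"
proof -
  let ?K = "min (n div w) w"
  define C where "C = real (n - w) ^ (w - 1) / fact (w - 1)"
  define \<mu> where "\<mu> = \<tau> / C"
  define q where "q = row_bad_prob m w"
  \<comment> \<open>Any column set would do, since the counts \<open>r k\<close> are the same for
    all of them.\<close>
  define W where "W = {1..w}"
  have W: "W \<in> col_sets n w" using w by (auto simp: W_def col_sets_def)
  define r where "r k = card {J \<in> nbr_families n w {W}. card J = k}" for k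
  have \<tau>0: "0 < \<tau>" and zero: "poly (phi w n) \<tau> = \<tau> * poly (pderiv (phi w n)) \<tau>"
    using \<tau> by (auto simp: first_positive_zero_def)
  \<comment> \<open>For \<open>w = n\<close> the polynomial has degree at most 1, so
    \<open>\<phi>(x) - x \<phi>'(x)\<close> is the constant 1 and has no zero.\<close>
  have "w \<noteq> n"
  proof
    assume "w = n"
    then have "?K = 1" using w by simp
    then have "poly (phi w n) \<tau> - \<tau> * poly (pderiv (phi w n)) \<tau> = 1"
      unfolding poly_phi poly_pderiv_phi by simp
    then show False using zero by simp
  qed
  then have n: "w < n" using w by simp
  then have C: "0 < C" by (simp add: C_def)
  have \<mu>0: "0 < \<mu>" using \<tau>0 C by (simp add: \<mu>_def)
  have coeff: "real (w choose k) * Gamma_tilde k w n * \<tau> ^ k = real (r k) * \<mu> ^ k" if "k \<in> {1..?K}" for k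
  proof -
    have "real (r k) = real (w choose k) * Gamma_tilde k w n * C ^ k"
      unfolding C_def r_def using that card_nbr_families[OF W _ n, of k] w(1) by simp
    then show ?thesis using C by (simp add: \<mu>_def power_divide)
  qed
  have phi: "poly (phi w n) \<tau> = 1 + (\<Sum>k = 1..?K. real (r k) * \<mu> ^ k)"
    unfolding poly_phi by (intro arg_cong2[where f = "(+)"] sum.cong refl coeff)
  have dphi: "\<tau> * poly (pderiv (phi w n)) \<tau> = (\<Sum>k = 1..?K. real k * (real (r k) * \<mu> ^ k))"
    unfolding poly_pderiv_phi by (intro sum.cong refl) (simp only: coeff)
  have phi1: "1 \<le> poly (phi w n) \<tau>"
    unfolding phi using \<mu>0 by (simp add: sum_nonneg)
  \<comment> \<open>The equation for \<open>\<tau>\<close> reads: the sum of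
    \<open>(k - 1) * r k * \<mu> ^ k\<close> is 1. Some term is nonzero; it has
    \<open>k \<ge> 2\<close>, and its coefficient is an integer, hence at least 1, so
    \<open>\<mu> > 1\<close> would push the sum above 1.\<close>
  have "\<mu> \<le> 1"
  proof (rule ccontr)
    assume "\<not> \<mu> \<le> 1"
    let ?t = "\<lambda>k. (real k - 1) * real (r k) * \<mu> ^ k"
    have sum1: "(\<Sum>k = 1..?K. ?t k) = 1"
      using zero unfolding phi dphi by (simp add: algebra_simps sum_subtractf)
    have nonneg: "0 \<le> ?t k" if "k \<in> {1..?K}" for k
      using that \<mu>0 by simp
    obtain k where k: "k \<in> {1..?K}" "?t k \<noteq> 0"
      using sum1 by (metis (no_types, lifting) sum.neutral zero_neq_one)
    then have "2 \<le> k" "1 \<le> r k" by (auto simp: not_less_eq_eq[symmetric] intro: ccontr)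
    then have r1: "1 \<le> (real k - 1) * real (r k)"
      using mult_mono[of 1 "real k - 1" 1 "real (r k)"] by simp
    have "1 < \<mu> ^ k"
      using \<open>\<not> \<mu> \<le> 1\<close> \<open>2 \<le> k\<close> by (intro one_less_power) auto
    also have "\<mu> ^ k \<le> ?t k"
      using mult_right_mono[OF r1, of "\<mu> ^ k"] \<mu>0 by simp
    also have "?t k \<le> (\<Sum>k = 1..?K. ?t k)"
      using k nonneg by (intro member_le_sum) auto
    finally show False using sum1 by simp
  qed
  have q: "0 < q" "q < 1" using row_bad_prob_bounds[OF w(1,3)] by (simp_all add: q_def)
  have d: "0 < poly (pderiv (phi w n)) \<tau>"
    using zero phi1 \<tau>0 by (metis less_le_trans zero_less_mult_pos zero_less_one)
  \<comment> \<open>Exponentiating the bound on \<open>N\<close> gives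
    \<open>q ^ N * \<phi>'(\<tau>) * C \<le> 1\<close>. Multiplying by \<open>\<tau>\<close> and
    using \<open>\<tau> * \<phi>'(\<tau>) = \<phi>(\<tau>)\<close> turns this into the
    claim.\<close>
  have le: "q ^ N * poly (phi w n) \<tau> \<le> \<mu>"
  proof -
    have "0 < real m ^ w" "0 < real m ^ w - fact w * real (m choose w)"
      using q(1) w by (auto simp: q_def row_bad_prob_def zero_less_divide_iff)
    then have "ln (real m ^ w) - ln (real m ^ w - fact w * real (m choose w)) = - ln q"
      by (simp add: q_def row_bad_prob_def ln_div)
    moreover have "ln (poly (pderiv (phi w n)) \<tau>) + (real w - 1) * ln (real n - real w) - ln (fact (w - 1))
        = ln (poly (pderiv (phi w n)) \<tau> * C)"
      using d n w(1) by (simp add: C_def ln_mult ln_div ln_realpow of_nat_diff)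
    ultimately have "ln (poly (pderiv (phi w n)) \<tau> * C) / (- ln q) \<le> real N"
      using N by (simp add: PHF_bound_def)
    moreover have "0 < - ln q" using q by simp
    ultimately have "ln (poly (pderiv (phi w n)) \<tau> * C) \<le> real N * (- ln q)"
      by (simp only: pos_divide_le_eq)
    then have "ln (q ^ N) + ln (poly (pderiv (phi w n)) \<tau> * C) \<le> 0"
      using q by (simp add: ln_realpow)
    then have "ln (q ^ N * (poly (pderiv (phi w n)) \<tau> * C)) \<le> 0"
      using q d C by (simp add: ln_mult)
    then have "q ^ N * (poly (pderiv (phi w n)) \<tau> * C) \<le> 1"
      using q d C by (subst (asm) ln_le_zero_iff) auto
    then have "q ^ N * (poly (pderiv (phi w n)) \<tau> * C) * \<tau> \<le> 1 * \<tau>"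
      using \<tau>0 by (intro mult_right_mono) auto
    then show ?thesis
      using C unfolding zero \<mu>_def by (simp add: field_simps)
  qed
  have "mean (mats N n m) (potential N n m w h) \<le> (n choose w) * \<mu>"
  proof (rule mean_potential_le)
    show "0 < q ^ N" "1 \<le> m" using q w by auto
    have "q ^ N * 1 \<le> q ^ N * poly (phi w n) \<tau>" using q phi1 by (intro mult_left_mono) auto
    then show "q ^ N \<le> \<mu>" using le by simp
    fix V assume V: "V \<in> col_sets n w"
    show "q ^ N * (\<Sum>J\<in>nbr_families n w {V}. \<mu> ^ card J) \<le> \<mu>"
      using le sum_nbr_families[OF V _ n, of \<tau>] w(1) by (simp add: \<mu>_def C_def)
    show "mean (mats N n m) (\<lambda>A. of_bool (bad_event N V A)) = q ^ N"
      unfolding q_def using V w by (intro mean_bad_event) (auto simp: col_sets_def)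
  qed
  also have "\<dots> \<le> real (n choose w)"
    using \<open>\<mu> \<le> 1\<close> \<mu>0 by (simp add: mult_left_le)
  finally show ?thesis .
qed

text \<open>\<open>X\<close> stands for \<open>N + n + m\<close> and \<open>M\<close> for
  \<open>n choose w\<close>. The largest degree comes from the checks, where \<open>M\<close> enters
  twice: once per check and once through the number of steps.\<close>

lemma time_bound_polynomial:
  fixes X w :: nat
  assumes "1 \<le> X" "N \<le> X" "n \<le> X" "M \<le> X ^ w" "s \<le> C1 * X ^ d1" "c \<le> C2 * X ^ d2"
  shows "N * n * s + (M * N * (w choose 2) * c * (1 + M) + N * w * s * M)
    \<le> (C1 + 2 * (w choose 2) * C2 + w * C1) * X ^ (2 * w + d1 + d2 + 2)"
proof -
  let ?e = "2 * w + d1 + d2 + 2"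
  have up: "X ^ a \<le> X ^ ?e" if "a \<le> ?e" for a
    using assms(1) that by (intro power_increasing) auto
  have "1 \<le> X ^ w" using assms(1) by (rule one_le_power)
  then have "1 + M \<le> 2 * X ^ w" using assms(4) by linarith
  then have "M * N * (w choose 2) * c * (1 + M) \<le> X ^ w * X * (w choose 2) * (C2 * X ^ d2) * (2 * X ^ w)"
    using assms by (intro mult_mono) auto
  also have "\<dots> = (2 * (w choose 2) * C2) * X ^ (2 * w + d2 + 1)"
    unfolding power_add mult_2[of w] by (simp add: mult_ac)
  also have "\<dots> \<le> (2 * (w choose 2) * C2) * X ^ ?e"
    by (intro mult_left_mono up) auto
  finally have 2: "M * N * (w choose 2) * c * (1 + M) \<le> (2 * (w choose 2) * C2) * X ^ ?e" .
  have "N * n * s \<le> X * X * (C1 * X ^ d1)" using assms by (intro mult_mono) auto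
  also have "\<dots> = C1 * X ^ (d1 + 2)" by (simp add: power_add power2_eq_square mult_ac)
  also have "\<dots> \<le> C1 * X ^ ?e" by (intro mult_left_mono up) auto
  finally have 1: "N * n * s \<le> C1 * X ^ ?e" .
  have "N * w * s * M \<le> X * w * (C1 * X ^ d1) * X ^ w" using assms by (intro mult_mono) auto
  also have "\<dots> = w * C1 * X ^ (w + d1 + 1)" by (simp add: power_add mult_ac)
  also have "\<dots> \<le> w * C1 * X ^ ?e" by (intro mult_left_mono up) auto
  finally show ?thesis unfolding add_mult_distrib using 1 2 by linarith
qed

lemma selection_rule_exists: "\<exists>sel. selection_rule N n w sel"
  unfolding selection_rule_def
  by (rule exI[of _ "\<lambda>h. SOME W. W \<in> bad_sets N n w (last h)"]) (auto intro: someI)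

theorem theorem1p2:
  fixes w :: nat
  assumes "2 \<le> w"
  shows
    "(\<forall>N n m :: nat. \<forall>\<tau> :: real.
        1 \<le> N \<and> 1 \<le> n \<and> 1 \<le> m \<and> w \<le> n \<and> w \<le> m
        \<and> first_positive_zero (\<lambda>x. poly (phi w n) x - x * poly (pderiv (phi w n)) x) \<tau>
        \<and> real N \<ge> PHF_bound w n m \<tau>
        \<longrightarrow> (\<exists>A. is_PHF N n m w A))
     \<and>
     (\<forall>s c :: nat \<Rightarrow> nat \<Rightarrow> nat \<Rightarrow> nat. poly_bounded s \<and> poly_bounded c \<longrightarrow>
       (\<exists>C d :: nat. \<forall>N n m :: nat. \<forall>\<tau> :: real. \<forall>sel :: mat list \<Rightarrow> nat set.
          1 \<le> N \<and> 1 \<le> n \<and> 1 \<le> m \<and> w \<le> n \<and> w \<le> m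
          \<and> first_positive_zero (\<lambda>x. poly (phi w n) x - x * poly (pderiv (phi w n)) x) \<tau>
          \<and> real N \<ge> PHF_bound w n m \<tau>
          \<and> selection_rule N n w sel
          \<longrightarrow> (AE \<omega> in mt_space N n m. \<exists>A. mt_outputs N n w sel \<omega> A \<and> is_PHF N n m w A)
            \<and> (\<integral>\<^sup>+ \<omega>. mt_time (s N n m) (c N n m) N n w sel \<omega> \<partial>mt_space N n m)
                \<le> of_nat (C * (N + n + m) ^ d)))"
proof (intro conjI allI impI)
  fix N n m :: nat and \<tau> :: real
  assume *: "1 \<le> N \<and> 1 \<le> n \<and> 1 \<le> m \<and> w \<le> n \<and> w \<le> m
        \<and> first_positive_zero (\<lambda>x. poly (phi w n) x - x * poly (pderiv (phi w n)) x) \<tau>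
        \<and> real N \<ge> PHF_bound w n m \<tau>"
  obtain sel where "selection_rule N n w sel" using selection_rule_exists by blast
  then have AE: "AE \<omega> in mt_space N n m. \<exists>A. mt_outputs N n w sel \<omega> A \<and> is_PHF N n m w A"
    using * assms mean_potential_le_binomial[of w n m \<tau> N] by (intro mt_analysis(1)) auto
  interpret prob_space "mt_space N n m"
    unfolding mt_space_def using *
    by (intro prob_space_PiM prob_space_uniform_count_measure) auto
  \<comment> \<open>An almost sure event in a probability space is not empty, so some run outputs
    the desired matrix.\<close>
  show "\<exists>A. is_PHF N n m w A"
    using eventually_happens'[OF ae_filter_bot AE] by blast
next
  fix s c :: "nat \<Rightarrow> nat \<Rightarrow> nat \<Rightarrow> nat"
  assume "poly_bounded s \<and> poly_bounded c"
  then obtain C1 d1 C2 d2 where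
    s: "\<And>N n m. 1 \<le> N \<and> 1 \<le> n \<and> 1 \<le> m \<Longrightarrow> s N n m \<le> C1 * (N + n + m) ^ d1" and
    c: "\<And>N n m. 1 \<le> N \<and> 1 \<le> n \<and> 1 \<le> m \<Longrightarrow> c N n m \<le> C2 * (N + n + m) ^ d2"
    unfolding poly_bounded_def by meson
  show "\<exists>C d :: nat. \<forall>N n m :: nat. \<forall>\<tau> :: real. \<forall>sel :: mat list \<Rightarrow> nat set.
          1 \<le> N \<and> 1 \<le> n \<and> 1 \<le> m \<and> w \<le> n \<and> w \<le> m
          \<and> first_positive_zero (\<lambda>x. poly (phi w n) x - x * poly (pderiv (phi w n)) x) \<tau>
          \<and> real N \<ge> PHF_bound w n m \<tau>
          \<and> selection_rule N n w sel
          \<longrightarrow> (AE \<omega> in mt_space N n m. \<exists>A. mt_outputs N n w sel \<omega> A \<and> is_PHF N n m w A)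
            \<and> (\<integral>\<^sup>+ \<omega>. mt_time (s N n m) (c N n m) N n w sel \<omega> \<partial>mt_space N n m)
                \<le> of_nat (C * (N + n + m) ^ d)"
  \<comment> \<open>The constants remain schematic until the final \<open>show\<close>; they depend
    only on \<open>w\<close> and on the bounds for \<open>s\<close> and \<open>c\<close>.\<close>
  proof (intro exI allI impI)
    fix N n m :: nat and \<tau> :: real and sel :: "mat list \<Rightarrow> nat set"
    assume *: "1 \<le> N \<and> 1 \<le> n \<and> 1 \<le> m \<and> w \<le> n \<and> w \<le> m
          \<and> first_positive_zero (\<lambda>x. poly (phi w n) x - x * poly (pderiv (phi w n)) x) \<tau>
          \<and> real N \<ge> PHF_bound w n m \<tau>
          \<and> selection_rule N n w sel"
    let ?X = "N + n + m"
    have mt: "1 \<le> m" "1 \<le> w" "selection_rule N n w sel"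
      "\<And>h. mean (mats N n m) (potential N n m w h) \<le> real (n choose w)"
      using * assms mean_potential_le_binomial[of w n m \<tau> N] by auto
    have "n choose w \<le> n ^ w" using * by (intro binomial_le_pow) simp
    also have "\<dots> \<le> ?X ^ w" by (intro power_mono) auto
    finally have "n choose w \<le> ?X ^ w" .
    then have "N * n * s N n m + ((n choose w) * N * (w choose 2) * c N n m * (1 + (n choose w))
        + N * w * s N n m * (n choose w))
      \<le> (C1 + 2 * (w choose 2) * C2 + w * C1) * ?X ^ (2 * w + d1 + d2 + 2)"
      using * s c by (intro time_bound_polynomial) auto
    then have "(of_nat (N * n * s N n m + ((n choose w) * N * (w choose 2) * c N n m * (1 + (n choose w))
        + N * w * s N n m * (n choose w))) :: ennreal)
      \<le> of_nat ((C1 + 2 * (w choose 2) * C2 + w * C1) * ?X ^ (2 * w + d1 + d2 + 2))"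
      by (simp only: of_nat_le_iff)
    then show "(AE \<omega> in mt_space N n m. \<exists>A. mt_outputs N n w sel \<omega> A \<and> is_PHF N n m w A)
            \<and> (\<integral>\<^sup>+ \<omega>. mt_time (s N n m) (c N n m) N n w sel \<omega> \<partial>mt_space N n m)
                \<le> of_nat ((C1 + 2 * (w choose 2) * C2 + w * C1) * ?X ^ (2 * w + d1 + d2 + 2))"
      using mt_analysis(1)[OF mt] order_trans[OF mt_analysis(2)[OF mt]] by blast
  qed
qed

end
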